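(* Let $\mathcal{C}$ and $\mathcal{D}$ be finitely generated categories. (i) If $L_1,L_2\subseteq\mathcal{C}(A,B)$ are context-free languages of arrows, so is their union $L_1\cup L_2\subseteq\mathcal{C}(A,B)$. (ii) If $L_1\subseteq\mathcal{C}(A_1,B_1),\dots,L_n\subseteq\mathcal{C}(A_n,B_n)$ are context-free languages of arrows and $w_0{-}w_1{-}\cdots{-}w_n:(A_1,B_1),\dots,(A_n,B_n)\to(A,B)$ is an operation of $\mathcal{W}[\mathcal{C}]$, then the spliced concatenation $w_0L_1w_1\cdots L_nw_n=\{w_0u_1w_1\cdots u_nw_n\mid u_1\in L_1,\dots,u_n\in L_n\}\subseteq\mathcal{C}(A,B)$ is also a context-free language of arrows. (iii) If $L\subseteq\mathcal{C}(A,B)$ is a context-free language of arrows and $F:\mathcal{C}\to\mathcal{D}$ is a functor, then the functorial image $F(L)\subseteq\mathcal{D}(F(A),F(B))$ is also a context-free language of arrows.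
   Context: "Operad" means colored non-symmetric operad (multicategory); a functor of operads maps colors and operations preserving types, identities and composition. A constant is an operation of arity $0$; $\alpha:S$ means $\alpha$ is a constant with output color $S$. Composition of arrows in categories is written in diagrammatic order. A species $\mathcal{S}$ consists of a set $C$ of colors, a set $V$ of nodes, and functions $i:V\to C^*$ (input colors), $o:V\to C$ (output color). It is finite if $C$ and $V$ are finite. $\mathsf{Free}\,\mathcal{S}$ is the free operad on $\mathcal{S}$ (same colors, operations freely generated by the nodes). The operad $\mathcal{W}[\mathcal{C}]$ of spliced arrows of a category $\mathcal{C}$ has as colors the pairs $(A,B)$ of objects; an $n$-ary operation $(A_1,B_1),\dots,(A_n,B_n)\to(A,B)$ is a sequence $w_0{-}\cdots{-}w_n$ of arrows $w_i:B_i\to A_{i+1}$ ($0\le i\le n$, with $B_0=A$, $A_{n+1}=B$). Composition substitutes spliced arrows for the gaps "$-$", interpreting juxtaposition as composition in $\mathcal{C}$; the identity on $(A,B)$ is $\mathrm{id}_A{-}\mathrm{id}_B$. Constants of color $(A,B)$ are exactly arrows $A\to B$. A context-free grammar of arrows $G=(\mathcal{C},\mathcal{S},S,p)$ consists of a finitely generated category $\mathcal{C}$, a finite species $\mathcal{S}$, a color $S$ of $\mathcal{S}$, and a functor of operads $p:\mathsf{Free}\,\mathcal{S}\to\mathcal{W}[\mathcal{C}]$. Its language is $L_G=\{p(\alpha)\mid\alpha:S \text{ a constant of }\mathsf{Free}\,\mathcal{S}\}\subseteq\mathcal{C}(A,B)$ where $p(S)=(A,B)$. A subset of $\mathcal{C}(A,B)$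 is a context-free language of arrows if it equals $L_G$ for some such $G$ with $p(S)=(A,B)$. *)

theory Defs
  imports Main
begin

section \<open>Categories and functors\<close>

text \<open>Composition is written in diagrammatic order: \<^term>\<open>Comp C f g\<close> is \<open>f\<close> followed by \<open>g\<close>.
  Values of the record fields outside the carriers are irrelevant.\<close>

record ('o, 'a) category =
  Obj :: "'o set"
  Arr :: "'a set"
  Dom :: "'a \<Rightarrow> 'o"
  Cod :: "'a \<Rightarrow> 'o"
  Ident :: "'o \<Rightarrow> 'a"
  Comp :: "'a \<Rightarrow> 'a \<Rightarrow> 'a"

locale category =
  fixes C :: "('o, 'a) category"
  assumes Dom_Obj: "f \<in> Arr C \<Longrightarrow> Dom C f \<in> Obj C"
    and Cod_Obj: "f \<in> Arr C \<Longrightarrow> Cod C f \<in> Obj C"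
    and Ident_Arr: "A \<in> Obj C \<Longrightarrow> Ident C A \<in> Arr C"
    and Dom_Ident: "A \<in> Obj C \<Longrightarrow> Dom C (Ident C A) = A"
    and Cod_Ident: "A \<in> Obj C \<Longrightarrow> Cod C (Ident C A) = A"
    and Comp_Arr: "f \<in> Arr C \<Longrightarrow> g \<in> Arr C \<Longrightarrow> Cod C f = Dom C g \<Longrightarrow> Comp C f g \<in> Arr C"
    and Dom_Comp: "f \<in> Arr C \<Longrightarrow> g \<in> Arr C \<Longrightarrow> Cod C f = Dom C g \<Longrightarrow> Dom C (Comp C f g) = Dom C f"
    and Cod_Comp: "f \<in> Arr C \<Longrightarrow> g \<in> Arr C \<Longrightarrow> Cod C f = Dom C g \<Longrightarrow> Cod C (Comp C f g) = Cod C g"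
    and Ident_Comp: "f \<in> Arr C \<Longrightarrow> Comp C (Ident C (Dom C f)) f = f"
    and Comp_Ident: "f \<in> Arr C \<Longrightarrow> Comp C f (Ident C (Cod C f)) = f"
    and Comp_assoc: "f \<in> Arr C \<Longrightarrow> g \<in> Arr C \<Longrightarrow> h \<in> Arr C \<Longrightarrow>
      Cod C f = Dom C g \<Longrightarrow> Cod C g = Dom C h \<Longrightarrow>
      Comp C (Comp C f g) h = Comp C f (Comp C g h)"

text \<open>The arrows that are composites of finite (possibly empty) paths of arrows from \<open>X\<close>.\<close>

inductive_set generated :: "('o, 'a) category \<Rightarrow> 'a set \<Rightarrow> 'a set"
  for C :: "('o, 'a) category" and X :: "'a set" where
  generated_Ident: "A \<in> Obj C \<Longrightarrow> Ident C A \<in> generated C X"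
| generated_Comp: "f \<in> generated C X \<Longrightarrow> x \<in> X \<Longrightarrow> Cod C f = Dom C x \<Longrightarrow>
    Comp C f x \<in> generated C X"

text \<open>A quotient of the free category on a finite graph: finitely many objects and finitely many
  generating arrows.\<close>

definition finitely_generated :: "('o, 'a) category \<Rightarrow> bool" where
  "finitely_generated C \<longleftrightarrow>
    finite (Obj C) \<and> (\<exists>X. finite X \<and> X \<subseteq> Arr C \<and> Arr C \<subseteq> generated C X)"

locale cat_functor = category C + D: category D
  for C :: "('o, 'a) category" and D :: "('p, 'b) category"
    and Fo :: "'o \<Rightarrow> 'p" and Fa :: "'a \<Rightarrow> 'b" +
  assumes Fo_Obj: "A \<in> Obj C \<Longrightarrow> Fo A \<in> Obj D"
    and Fa_Arr: "f \<in> Arr C \<Longrightarrow> Fa f \<in> Arr D"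
    and Dom_Fa: "f \<in> Arr C \<Longrightarrow> Dom D (Fa f) = Fo (Dom C f)"
    and Cod_Fa: "f \<in> Arr C \<Longrightarrow> Cod D (Fa f) = Fo (Cod C f)"
    and Fa_Ident: "A \<in> Obj C \<Longrightarrow> Fa (Ident C A) = Ident D (Fo A)"
    and Fa_Comp: "f \<in> Arr C \<Longrightarrow> g \<in> Arr C \<Longrightarrow> Cod C f = Dom C g \<Longrightarrow>
      Fa (Comp C f g) = Comp D (Fa f) (Fa g)"

section \<open>Colored non-symmetric operads\<close>

record ('c, 'm) operad =
  Colors :: "'c set"
  Ops :: "'m set"
  Ins :: "'m \<Rightarrow> 'c list"
  Out :: "'m \<Rightarrow> 'c"
  Unit :: "'c \<Rightarrow> 'm"
  Plug :: "'m \<Rightarrow> 'm list \<Rightarrow> 'm"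

definition pluggable :: "('c, 'm) operad \<Rightarrow> 'm \<Rightarrow> 'm list \<Rightarrow> bool" where
  "pluggable P f gs \<longleftrightarrow> f \<in> Ops P \<and> set gs \<subseteq> Ops P \<and> map (Out P) gs = Ins P f"

locale operad =
  fixes P :: "('c, 'm) operad"
  assumes Ins_Colors: "f \<in> Ops P \<Longrightarrow> set (Ins P f) \<subseteq> Colors P"
    and Out_Colors: "f \<in> Ops P \<Longrightarrow> Out P f \<in> Colors P"
    and Unit_Ops: "c \<in> Colors P \<Longrightarrow> Unit P c \<in> Ops P"
    and Ins_Unit: "c \<in> Colors P \<Longrightarrow> Ins P (Unit P c) = [c]"
    and Out_Unit: "c \<in> Colors P \<Longrightarrow> Out P (Unit P c) = c"
    and Plug_Ops: "pluggable P f gs \<Longrightarrow> Plug P f gs \<in> Ops P"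
    and Ins_Plug: "pluggable P f gs \<Longrightarrow> Ins P (Plug P f gs) = concat (map (Ins P) gs)"
    and Out_Plug: "pluggable P f gs \<Longrightarrow> Out P (Plug P f gs) = Out P f"
    and Unit_Plug: "f \<in> Ops P \<Longrightarrow> Plug P (Unit P (Out P f)) [f] = f"
    and Plug_Unit: "f \<in> Ops P \<Longrightarrow> Plug P f (map (Unit P) (Ins P f)) = f"
    and Plug_assoc: "pluggable P f gs \<Longrightarrow> list_all2 (pluggable P) gs hss \<Longrightarrow>
      Plug P (Plug P f gs) (concat hss) = Plug P f (map2 (Plug P) gs hss)"

definition operad_functor ::
    "('c, 'm) operad \<Rightarrow> ('d, 'n) operad \<Rightarrow> ('c \<Rightarrow> 'd) \<Rightarrow> ('m \<Rightarrow> 'n) \<Rightarrow> bool" where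
  "operad_functor P Q pc pm \<longleftrightarrow>
    (\<forall>c \<in> Colors P. pc c \<in> Colors Q) \<and>
    (\<forall>f \<in> Ops P. pm f \<in> Ops Q \<and> Ins Q (pm f) = map pc (Ins P f) \<and> Out Q (pm f) = pc (Out P f)) \<and>
    (\<forall>c \<in> Colors P. pm (Unit P c) = Unit Q (pc c)) \<and>
    (\<forall>f gs. pluggable P f gs \<longrightarrow> pm (Plug P f gs) = Plug Q (pm f) (map pm gs))"

definition constants :: "('c, 'm) operad \<Rightarrow> 'c \<Rightarrow> 'm set" where
  "constants P c = {f \<in> Ops P. Ins P f = [] \<and> Out P f = c}"

section \<open>Species and free operads\<close>

record ('c, 'v) species =
  SColors :: "'c set"
  Nodes :: "'v set"
  NIn :: "'v \<Rightarrow> 'c list"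
  NOut :: "'v \<Rightarrow> 'c"

definition species :: "('c, 'v) species \<Rightarrow> bool" where
  "species S \<longleftrightarrow> (\<forall>v \<in> Nodes S. set (NIn S v) \<subseteq> SColors S \<and> NOut S v \<in> SColors S)"

definition finite_species :: "('c, 'v) species \<Rightarrow> bool" where
  "finite_species S \<longleftrightarrow> species S \<and> finite (SColors S) \<and> finite (Nodes S)"

text \<open>Operations of the free operad are trees of nodes. A leaf \<open>Hole c\<close> is an input of color \<open>c\<close>;
  on its own it is the identity operation.\<close>

datatype ('c, 'v) tree = Hole 'c | Node 'v "('c, 'v) tree list"

fun tree_root :: "('c, 'v) species \<Rightarrow> ('c, 'v) tree \<Rightarrow> 'c" where
  "tree_root S (Hole c) = c"
| "tree_root S (Node v ts) = NOut S v"

fun holes :: "('c, 'v) tree \<Rightarrow> 'c list" where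
  "holes (Hole c) = [c]"
| "holes (Node v ts) = concat (map holes ts)"

fun well_typed :: "('c, 'v) species \<Rightarrow> ('c, 'v) tree \<Rightarrow> bool" where
  "well_typed S (Hole c) \<longleftrightarrow> c \<in> SColors S"
| "well_typed S (Node v ts) \<longleftrightarrow>
    v \<in> Nodes S \<and> map (tree_root S) ts = NIn S v \<and> (\<forall>t \<in> set ts. well_typed S t)"

text \<open>\<open>graft t us\<close> replaces the holes of \<open>t\<close>, from left to right, by the trees \<open>us\<close>.\<close>

fun graft :: "('c, 'v) tree \<Rightarrow> ('c, 'v) tree list \<Rightarrow> ('c, 'v) tree"
  and grafts :: "('c, 'v) tree list \<Rightarrow> ('c, 'v) tree list \<Rightarrow> ('c, 'v) tree list" where
  "graft (Hole c) us = hd us"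
| "graft (Node v ts) us = Node v (grafts ts us)"
| "grafts [] us = []"
| "grafts (t # ts) us =
    graft t (take (length (holes t)) us) # grafts ts (drop (length (holes t)) us)"

definition Free :: "('c, 'v) species \<Rightarrow> ('c, ('c, 'v) tree) operad" where
  "Free S = \<lparr>Colors = SColors S, Ops = {t. well_typed S t}, Ins = holes, Out = tree_root S,
    Unit = Hole, Plug = graft\<rparr>"

section \<open>The operad of spliced arrows\<close>

text \<open>A spliced arrow \<open>w\<^sub>0-w\<^sub>1-\<dots>-w\<^sub>n\<close> is the nonempty list \<open>[w\<^sub>0, \<dots>, w\<^sub>n]\<close>. Since the domains and
  codomains of the \<open>w\<^sub>i\<close> determine its colors, every nonempty list of arrows is an operation.\<close>

text \<open>Juxtaposition composes the last arrow of \<open>ws\<close> with the first arrow of \<open>us\<close>.\<close>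

definition juxtapose :: "('o, 'a) category \<Rightarrow> 'a list \<Rightarrow> 'a list \<Rightarrow> 'a list" where
  "juxtapose C ws us = butlast ws @ Comp C (last ws) (hd us) # tl us"

fun plug_arrows :: "('o, 'a) category \<Rightarrow> 'a list \<Rightarrow> 'a list list \<Rightarrow> 'a list" where
  "plug_arrows C (w # ws) (u # us) = juxtapose C [w] (juxtapose C u (plug_arrows C ws us))"
| "plug_arrows C ws [] = ws"
| "plug_arrows C [] (u # us) = []"

definition Spliced :: "('o, 'a) category \<Rightarrow> ('o \<times> 'o, 'a list) operad" where
  "Spliced C = \<lparr>Colors = Obj C \<times> Obj C,
    Ops = {ws. ws \<noteq> [] \<and> set ws \<subseteq> Arr C},
    Ins = (\<lambda>ws. zip (map (Cod C) (butlast ws)) (map (Dom C) (tl ws))),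
    Out = (\<lambda>ws. (Dom C (hd ws), Cod C (last ws))),
    Unit = (\<lambda>(A, B). [Ident C A, Ident C B]),
    Plug = plug_arrows C\<rparr>"

section \<open>Context-free languages of arrows\<close>

record ('o, 'a, 'c, 'v) grammar =
  Base :: "('o, 'a) category"
  Spec :: "('c, 'v) species"
  Start :: "'c"
  PCol :: "'c \<Rightarrow> 'o \<times> 'o"
  POp :: "('c, 'v) tree \<Rightarrow> 'a list"

definition context_free_grammar :: "('o, 'a, 'c, 'v) grammar \<Rightarrow> bool" where
  "context_free_grammar G \<longleftrightarrow>
    category (Base G) \<and> finitely_generated (Base G) \<and>
    finite_species (Spec G) \<and> Start G \<in> SColors (Spec G) \<and>
    operad_functor (Free (Spec G)) (Spliced (Base G)) (PCol G) (POp G)"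

text \<open>An arrow \<open>w\<close> is identified with the constant \<open>[w]\<close> of the operad of spliced arrows.\<close>

definition language :: "('o, 'a, 'c, 'v) grammar \<Rightarrow> 'a set" where
  "language G = {w. [w] \<in> POp G ` constants (Free (Spec G)) (Start G)}"

text \<open>Only finite species occur, so nothing is lost by taking natural numbers as colors and nodes;
  see \<open>context_free_languageI\<close> below.\<close>

definition context_free_language ::
    "('o, 'a) category \<Rightarrow> 'o \<Rightarrow> 'o \<Rightarrow> 'a set \<Rightarrow> bool" where
  "context_free_language C A B L \<longleftrightarrow>
    (\<exists>G :: ('o, 'a, nat, nat) grammar. context_free_grammar G \<and> Base G = C \<and>
      PCol G (Start G) = (A, B) \<and> language G = L)"

fun spliced_composite :: "('o, 'a) category \<Rightarrow> 'a list \<Rightarrow> 'a list \<Rightarrow> 'a" where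
  "spliced_composite C (w # ws) (u # us) = Comp C w (Comp C u (spliced_composite C ws us))"
| "spliced_composite C ws us = hd ws"

definition spliced_concatenation :: "('o, 'a) category \<Rightarrow> 'a list \<Rightarrow> 'a set list \<Rightarrow> 'a set" where
  "spliced_concatenation C ws Ls =
    {spliced_composite C ws us | us. list_all2 (\<in>) us Ls}"

section \<open>Adequacy of the definitions\<close>

lemma Free_simps [simp]:
  "Colors (Free S) = SColors S" "Ops (Free S) = {t. well_typed S t}" "Ins (Free S) = holes"
  "Out (Free S) = tree_root S" "Unit (Free S) = Hole" "Plug (Free S) = graft"
  by (simp_all add: Free_def)

lemma Spliced_simps [simp]:
  "Colors (Spliced C) = Obj C \<times> Obj C"
  "Ops (Spliced C) = {ws. ws \<noteq> [] \<and> set ws \<subseteq> Arr C}"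
  "Ins (Spliced C) ws = zip (map (Cod C) (butlast ws)) (map (Dom C) (tl ws))"
  "Out (Spliced C) ws = (Dom C (hd ws), Cod C (last ws))"
  "Unit (Spliced C) (A, B) = [Ident C A, Ident C B]"
  "Plug (Spliced C) = plug_arrows C"
  by (simp_all add: Spliced_def)

subsection \<open>The free operad\<close>

lemma tree_root_Colors: "species S \<Longrightarrow> well_typed S t \<Longrightarrow> tree_root S t \<in> SColors S"
  by (cases t) (auto simp: species_def)

lemma holes_Colors: "well_typed S t \<Longrightarrow> set (holes t) \<subseteq> SColors S"
  by (induction t) auto

lemma map_eq_append:
  assumes "map f us = xs @ ys"
  shows "map f (take (length xs) us) = xs" "map f (drop (length xs) us) = ys"
  using assms by (simp_all add: take_map[symmetric] drop_map[symmetric])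

lemma graft_typed:
  "well_typed S t \<Longrightarrow> map (tree_root S) us = holes t \<Longrightarrow> \<forall>u \<in> set us. well_typed S u \<Longrightarrow>
    well_typed S (graft t us) \<and> tree_root S (graft t us) = tree_root S t \<and>
    holes (graft t us) = concat (map holes us)"
  "\<forall>t \<in> set ts. well_typed S t \<Longrightarrow> map (tree_root S) us = concat (map holes ts) \<Longrightarrow>
    \<forall>u \<in> set us. well_typed S u \<Longrightarrow>
    (\<forall>t \<in> set (grafts ts us). well_typed S t) \<and>
    map (tree_root S) (grafts ts us) = map (tree_root S) ts \<and>
    concat (map holes (grafts ts us)) = concat (map holes us)"
proof (induction t us and ts us rule: graft_grafts.induct)
  case (1 c us)
  then show ?case by (cases us) auto
next
  case (2 v ts us)
  then show ?case by simp
next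
  case (3 us)
  then show ?case by simp
next
  case (4 t ts us)
  let ?n = "length (holes t)"
  have "map (tree_root S) us = holes t @ concat (map holes ts)"
    using "4.prems"(2) by simp
  note m = map_eq_append[OF this]
  have w: "\<forall>u \<in> set (take ?n us). well_typed S u" "\<forall>u \<in> set (drop ?n us). well_typed S u"
    using "4.prems"(3) by (auto dest: in_set_takeD in_set_dropD)
  have c: "concat (map holes (take ?n us)) @ concat (map holes (drop ?n us)) = concat (map holes us)"
    by (metis append_take_drop_id concat_append map_append)
  have wt: "well_typed S t" "\<forall>t \<in> set ts. well_typed S t"
    using "4.prems"(1) by simp_all
  show ?case
    using "4.IH"(1)[OF wt(1) m(1) w(1)] "4.IH"(2)[OF wt(2) m(2) w(2)] c wt by simp
qed

lemma grafts_append: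
  assumes "list_all2 (\<lambda>t us. length (holes t) = length us) ts uss"
  shows "grafts ts (concat uss) = map2 graft ts uss"
  using assms by (induction rule: list_all2_induct) simp_all

lemma graft_Hole: "graft t (map Hole (holes t)) = t"
proof (induction t)
  case (Hole c)
  then show ?case by simp
next
  case (Node v ts)
  have "grafts ts (concat (map (map Hole \<circ> holes) ts)) = ts"
    using Node.IH by (induction ts) simp_all
  then show ?case by (simp add: map_concat)
qed

lemma grafts_length [simp]: "length (grafts ts us) = length ts"
  by (induction ts arbitrary: us) simp_all

lemma graft_assoc:
  fixes t :: "('c, 'v) tree" and ts :: "('c, 'v) tree list"
  shows "length us = length (holes t) \<Longrightarrow>
    list_all2 (\<lambda>u hs. length hs = length (holes u)) us hss \<Longrightarrow>
    graft (graft t us) (concat hss) = graft t (map2 graft us hss) \<and>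
    length (holes (graft t us)) = length (concat hss)"
  "length us = length (concat (map holes ts)) \<Longrightarrow>
    list_all2 (\<lambda>u hs. length hs = length (holes u)) us hss \<Longrightarrow>
    grafts (grafts ts us) (concat hss) = grafts ts (map2 graft us hss) \<and>
    length (concat (map holes (grafts ts us))) = length (concat hss)"
proof (induction t us and ts us arbitrary: hss and hss rule: graft_grafts.induct)
  case (1 c us)
  then obtain u where "us = [u]" by (cases us) simp_all
  moreover from this 1(2) obtain hs where "hss = [hs]" "length hs = length (holes u)"
    by (auto simp: list_all2_Cons1)
  ultimately show ?case by simp
next
  case (2 v ts us)
  then show ?case by simp
next
  case (3 us)
  then show ?case by simp
next
  case (4 t ts us)
  let ?n = "length (holes t)"
  let ?u1 = "take ?n us" and ?u2 = "drop ?n us" and ?h1 = "take ?n hss" and ?h2 = "drop ?n hss"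
  have l: "length ?u1 = length (holes t)" "length ?u2 = length (concat (map holes ts))"
    using "4.prems"(1) by simp_all
  have r: "list_all2 (\<lambda>u hs. length hs = length (holes u)) ?u1 ?h1"
      "list_all2 (\<lambda>u hs. length hs = length (holes u)) ?u2 ?h2"
    using "4.prems"(2) by (simp_all add: list_all2_takeI list_all2_dropI)
  note i1 = "4.IH"(1)[OF l(1) r(1)] and i2 = "4.IH"(2)[OF l(2) r(2)]
  have c: "concat hss = concat ?h1 @ concat ?h2"
    by (metis append_take_drop_id concat_append)
  have "length (holes (graft t ?u1)) = length (concat ?h1)"
    using i1 by blast
  then have "grafts (grafts (t # ts) us) (concat hss)
      = graft (graft t ?u1) (concat ?h1) # grafts (grafts ts ?u2) (concat ?h2)"
    by (simp add: c)
  also have "\<dots> = graft t (map2 graft ?u1 ?h1) # grafts ts (map2 graft ?u2 ?h2)"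
    using i1 i2 by simp
  also have "\<dots> = grafts (t # ts) (map2 graft us hss)"
    by (simp add: take_map drop_map take_zip drop_zip)
  finally have e: "grafts (grafts (t # ts) us) (concat hss) = grafts (t # ts) (map2 graft us hss)" .
  have "length (concat (map holes (grafts (t # ts) us))) = length (concat ?h1) + length (concat ?h2)"
    using i1 i2 by simp
  also have "\<dots> = length (concat hss)"
    by (subst c) simp
  finally show ?case using e by blast
qed

lemma operad_Free:
  assumes "species S"
  shows "operad (Free S)"
proof
  fix f gs assume "pluggable (Free S) f gs"
  then have "well_typed S f" "map (tree_root S) gs = holes f" "\<forall>g \<in> set gs. well_typed S g"
    by (auto simp: pluggable_def)
  note g = graft_typed(1)[OF this]
  show "Plug (Free S) f gs \<in> Ops (Free S)"
    "Ins (Free S) (Plug (Free S) f gs) = concat (map (Ins (Free S)) gs)"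
    "Out (Free S) (Plug (Free S) f gs) = Out (Free S) f"
    using g by simp_all
next
  fix f gs hss
  assume p: "pluggable (Free S) f gs" and ps: "list_all2 (pluggable (Free S)) gs hss"
  have "length gs = length (holes f)"
    using p unfolding pluggable_def by (metis Free_simps(3) length_map)
  moreover have "list_all2 (\<lambda>u hs. length hs = length (holes u)) gs hss"
    using ps by (rule list_all2_mono) (metis Free_simps(3) length_map pluggable_def)
  ultimately show "Plug (Free S) (Plug (Free S) f gs) (concat hss)
      = Plug (Free S) f (map2 (Plug (Free S)) gs hss)"
    using graft_assoc(1)[of gs f hss] by simp
next
  fix f assume "f \<in> Ops (Free S)"
  then show "set (Ins (Free S) f) \<subseteq> Colors (Free S)" "Out (Free S) f \<in> Colors (Free S)"
    using holes_Colors tree_root_Colors[OF assms] by auto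
qed (simp_all add: graft_Hole)


text \<open>The universal property of the free operad: a functor out of it amounts to a choice of colors
  and of operations for the nodes.\<close>

fun free_extension :: "('d, 'm) operad \<Rightarrow> ('c \<Rightarrow> 'd) \<Rightarrow> ('v \<Rightarrow> 'm) \<Rightarrow> ('c, 'v) tree \<Rightarrow> 'm" where
  "free_extension P pc pn (Hole c) = Unit P (pc c)"
| "free_extension P pc pn (Node v ts) = Plug P (pn v) (map (free_extension P pc pn) ts)"

definition corolla :: "('c, 'v) species \<Rightarrow> 'v \<Rightarrow> ('c, 'v) tree" where
  "corolla S v = Node v (map Hole (NIn S v))"

lemma well_typed_corolla: "species S \<Longrightarrow> v \<in> Nodes S \<Longrightarrow> well_typed S (corolla S v)"
  by (auto simp: corolla_def species_def comp_def)

lemma graft_corolla: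
  assumes "length ts = length (NIn S v)"
  shows "graft (corolla S v) ts = Node v ts"
proof -
  have "grafts (map Hole cs) ts = ts" if "length ts = length cs" for cs :: "'a list"
    using that
  proof (induction cs arbitrary: ts)
    case (Cons c cs)
    then show ?case by (cases ts) simp_all
  qed simp
  with assms show ?thesis by (simp add: corolla_def)
qed

lemma extend_typed:
  assumes "operad P" "species S" "\<forall>c \<in> SColors S. pc c \<in> Colors P"
    and n: "\<forall>v \<in> Nodes S. pn v \<in> Ops P \<and> Ins P (pn v) = map pc (NIn S v) \<and> Out P (pn v) = pc (NOut S v)"
    and "well_typed S t"
  shows "free_extension P pc pn t \<in> Ops P \<and> Ins P (free_extension P pc pn t) = map pc (holes t) \<and>
    Out P (free_extension P pc pn t) = pc (tree_root S t)"
  using assms(5)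
proof (induction t)
  case (Hole c)
  then show ?case using assms(1,3) by (simp add: operad.Unit_Ops operad.Ins_Unit operad.Out_Unit)
next
  case (Node v ts)
  have "map (Out P) (map (free_extension P pc pn) ts) = map pc (map (tree_root S) ts)"
    unfolding map_map by (rule map_cong) (use Node in auto)
  also have "\<dots> = Ins P (pn v)"
    using Node.prems n by simp
  finally have p: "pluggable P (pn v) (map (free_extension P pc pn) ts)"
    using Node n by (auto simp: pluggable_def simp del: map_map)
  have "concat (map (Ins P) (map (free_extension P pc pn) ts)) = concat (map (map pc) (map holes ts))"
    using Node by (simp cong: map_cong)
  then show ?case
    using operad.Plug_Ops[OF assms(1) p] operad.Ins_Plug[OF assms(1) p]
      operad.Out_Plug[OF assms(1) p] Node n by (simp add: map_concat)
qed

lemma extend_graft: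
  assumes P: "operad P" "species S" "\<forall>c \<in> SColors S. pc c \<in> Colors P"
    and n: "\<forall>v \<in> Nodes S. pn v \<in> Ops P \<and> Ins P (pn v) = map pc (NIn S v) \<and> Out P (pn v) = pc (NOut S v)"
  defines "e \<equiv> free_extension P pc pn"
  shows "well_typed S t \<Longrightarrow> map (tree_root S) us = holes t \<Longrightarrow> \<forall>u \<in> set us. well_typed S u \<Longrightarrow>
      e (graft t us) = Plug P (e t) (map e us)"
    "\<forall>t \<in> set ts. well_typed S t \<Longrightarrow> map (tree_root S) us = concat (map holes ts) \<Longrightarrow>
      \<forall>u \<in> set us. well_typed S u \<Longrightarrow>
      \<exists>uss. us = concat uss \<and>
        list_all2 (\<lambda>t us. map (tree_root S) us = holes t) ts uss \<and>
        map e (grafts ts us) = map2 (Plug P) (map e ts) (map (map e) uss)"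
proof (induction t us and ts us rule: graft_grafts.induct)
  case (1 c us)
  then obtain u where u: "us = [u]" "well_typed S u" "tree_root S u = c" by (cases us) auto
  then show ?case
    using operad.Unit_Plug[OF P(1), of "e u"] extend_typed[OF P n u(2)] by (simp add: e_def)
next
  case (2 v ts us)
  then have ts: "\<forall>t \<in> set ts. well_typed S t" and v: "v \<in> Nodes S" "map (tree_root S) ts = NIn S v"
    by simp_all
  obtain uss where uss: "us = concat uss" "list_all2 (\<lambda>t us. map (tree_root S) us = holes t) ts uss"
    "map e (grafts ts us) = map2 (Plug P) (map e ts) (map (map e) uss)"
    using 2(1)[OF ts _ 2(4)] 2(3) by auto
  have typed: "well_typed S u \<Longrightarrow> e u \<in> Ops P \<and> Ins P (e u) = map pc (holes u) \<and>
    Out P (e u) = pc (tree_root S u)" for u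
    using extend_typed[OF P n] by (simp add: e_def)
  have "map (Out P) (map e ts) = map pc (map (tree_root S) ts)"
    using ts typed by simp
  then have p: "pluggable P (pn v) (map e ts)"
    using ts typed v n by (auto simp: pluggable_def)
  have "list_all2 (\<lambda>t us. pluggable P (e t) (map e us)) ts uss"
    unfolding list_all2_conv_all_nth
  proof (intro conjI allI impI)
    show "length ts = length uss" using uss(2) by (rule list_all2_lengthD)
    fix i assume i: "i < length ts"
    then have us: "\<forall>u \<in> set (uss ! i). well_typed S u"
      using 2(4) uss(1) \<open>length ts = length uss\<close> by (metis UN_I nth_mem set_concat)
    have t: "well_typed S (ts ! i)" using ts i by simp
    have h: "map (tree_root S) (uss ! i) = holes (ts ! i)"
      using list_all2_nthD[OF uss(2) i] .
    have "map (Out P) (map e (uss ! i)) = map pc (map (tree_root S) (uss ! i))"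
      unfolding map_map by (rule map_cong) (use us typed in auto)
    then show "pluggable P (e (ts ! i)) (map e (uss ! i))"
      using us t typed unfolding h by (auto simp: pluggable_def)
  qed
  then have "list_all2 (pluggable P) (map e ts) (map (map e) uss)"
    by (simp add: list_all2_map1 list_all2_map2)
  from operad.Plug_assoc[OF P(1) p this]
  show ?case using uss(1,3) by (simp add: e_def map_concat)
next
  case (3 us)
  then show ?case by (intro exI[of _ "[]"]) simp
next
  case (4 t ts us)
  let ?n = "length (holes t)"
  have "map (tree_root S) us = holes t @ concat (map holes ts)"
    using "4.prems"(2) by simp
  note m = map_eq_append[OF this]
  have w: "\<forall>u \<in> set (take ?n us). well_typed S u" "\<forall>u \<in> set (drop ?n us). well_typed S u"
    using "4.prems"(3) by (auto dest: in_set_takeD in_set_dropD)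
  have wt: "well_typed S t" "\<forall>t \<in> set ts. well_typed S t"
    using "4.prems"(1) by simp_all
  obtain uss where uss: "drop ?n us = concat uss"
    "list_all2 (\<lambda>t us. map (tree_root S) us = holes t) ts uss"
    "map e (grafts ts (drop ?n us)) = map2 (Plug P) (map e ts) (map (map e) uss)"
    using "4.IH"(2)[OF wt(2) m(2) w(2)] by blast
  show ?case
  proof (intro exI[of _ "take ?n us # uss"] conjI)
    show "us = concat (take ?n us # uss)"
      using uss(1) by (metis append_take_drop_id concat.simps(2))
    show "list_all2 (\<lambda>t us. map (tree_root S) us = holes t) (t # ts) (take ?n us # uss)"
      using uss(2) m(1) by simp
    show "map e (grafts (t # ts) us) =
        map2 (Plug P) (map e (t # ts)) (map (map e) (take ?n us # uss))"
      using uss(3) "4.IH"(1)[OF wt(1) m(1) w(1)] by simp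
  qed
qed

lemma operad_functor_extend:
  assumes "operad P" "species S" "\<forall>c \<in> SColors S. pc c \<in> Colors P"
    and "\<forall>v \<in> Nodes S. pn v \<in> Ops P \<and> Ins P (pn v) = map pc (NIn S v) \<and> Out P (pn v) = pc (NOut S v)"
  shows "operad_functor (Free S) P pc (free_extension P pc pn)"
    and "v \<in> Nodes S \<Longrightarrow> free_extension P pc pn (corolla S v) = pn v"
proof -
  show "operad_functor (Free S) P pc (free_extension P pc pn)"
    unfolding operad_functor_def
    using assms(3) extend_typed[OF assms] extend_graft(1)[OF assms]
    by (auto simp: pluggable_def subset_iff)
  show "free_extension P pc pn (corolla S v) = pn v" if "v \<in> Nodes S"
    using operad.Plug_Unit[OF assms(1), of "pn v"] assms(4) that
    by (simp add: corolla_def comp_def)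
qed

lemma operad_functor_Free_unique:
  assumes "species S" "operad_functor (Free S) P pc pm"
    and "\<forall>v \<in> Nodes S. pm (corolla S v) = pn v" and "well_typed S t"
  shows "pm t = free_extension P pc pn t"
  using assms(4)
proof (induction t)
  case (Hole c)
  then show ?case using assms(2) by (simp add: operad_functor_def)
next
  case (Node v ts)
  have l: "length ts = length (NIn S v)"
    using Node.prems by (metis length_map well_typed.simps(2))
  have "pluggable (Free S) (corolla S v) ts"
    using Node.prems well_typed_corolla[OF assms(1), of v]
    by (auto simp: pluggable_def corolla_def comp_def)
  then have "pm (graft (corolla S v) ts) = Plug P (pm (corolla S v)) (map pm ts)"
    using assms(2) by (simp add: operad_functor_def)
  moreover have "map pm ts = map (free_extension P pc pn) ts"
    using Node by simp
  ultimately show ?case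
    using Node.prems assms(3) graft_corolla[OF l] by simp
qed

subsection \<open>The operad of spliced arrows\<close>

lemma juxtapose_simps [simp]:
  "juxtapose C [w] (u # us) = Comp C w u # us"
  "ws \<noteq> [] \<Longrightarrow> juxtapose C (w # ws) us = w # juxtapose C ws us"
  by (simp_all add: juxtapose_def)

abbreviation spliced_ins :: "('o, 'a) category \<Rightarrow> 'a list \<Rightarrow> ('o \<times> 'o) list" where
  "spliced_ins C ws \<equiv> zip (map (Cod C) (butlast ws)) (map (Dom C) (tl ws))"

context category
begin

lemma juxtapose_typed:
  assumes "us \<noteq> []" "set us \<subseteq> Arr C"
  shows "ws \<noteq> [] \<Longrightarrow> set ws \<subseteq> Arr C \<Longrightarrow> Cod C (last ws) = Dom C (hd us) \<Longrightarrow>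
    juxtapose C ws us \<noteq> [] \<and> set (juxtapose C ws us) \<subseteq> Arr C \<and>
    Dom C (hd (juxtapose C ws us)) = Dom C (hd ws) \<and>
    Cod C (last (juxtapose C ws us)) = Cod C (last us) \<and>
    spliced_ins C (juxtapose C ws us) = spliced_ins C ws @ spliced_ins C us"
proof (induction ws rule: induct_list012)
  case (2 w)
  obtain u us' where "us = u # us'" using assms(1) by (cases us) auto
  then show ?case using 2 assms(2)
    by (cases us') (auto simp: Comp_Arr Dom_Comp Cod_Comp)
next
  case (3 w w' ws)
  let ?j = "juxtapose C (w' # ws) us"
  have j: "?j \<noteq> []" "set ?j \<subseteq> Arr C" "Dom C (hd ?j) = Dom C w'" "Cod C (last ?j) = Cod C (last us)"
    "spliced_ins C ?j = spliced_ins C (w' # ws) @ spliced_ins C us"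
    using 3 by auto
  then obtain x xs where "?j = x # xs" by (cases ?j) auto
  then show ?case using j 3(4) by simp
qed simp

lemma juxtapose_assoc:
  assumes "us \<noteq> []" "set us \<subseteq> Arr C" "vs \<noteq> []" "set vs \<subseteq> Arr C" "Cod C (last us) = Dom C (hd vs)"
  shows "ws \<noteq> [] \<Longrightarrow> set ws \<subseteq> Arr C \<Longrightarrow> Cod C (last ws) = Dom C (hd us) \<Longrightarrow>
    juxtapose C (juxtapose C ws us) vs = juxtapose C ws (juxtapose C us vs)"
proof (induction ws rule: induct_list012)
  case (2 w)
  obtain u us' where "us = u # us'" using assms(1) by (cases us) auto
  moreover obtain v vs' where "vs = v # vs'" using assms(3) by (cases vs) auto
  ultimately show ?case using 2 assms by (cases us') (auto simp: Comp_assoc)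
next
  case (3 w w' ws)
  have "juxtapose C (w' # ws) us \<noteq> []" by (simp add: juxtapose_def)
  with 3 show ?case by simp
qed simp

lemma juxtapose_Ident:
  "ws \<noteq> [] \<Longrightarrow> set ws \<subseteq> Arr C \<Longrightarrow> juxtapose C [Ident C (Dom C (hd ws))] ws = ws"
  "ws \<noteq> [] \<Longrightarrow> set ws \<subseteq> Arr C \<Longrightarrow> juxtapose C ws [Ident C (Cod C (last ws))] = ws"
proof -
  show "juxtapose C [Ident C (Dom C (hd ws))] ws = ws" if "ws \<noteq> []" "set ws \<subseteq> Arr C"
    using that by (cases ws) (simp_all add: Ident_Comp)
  show "juxtapose C ws [Ident C (Cod C (last ws))] = ws" if "ws \<noteq> []" "set ws \<subseteq> Arr C"
  proof -
    have "last ws \<in> Arr C" using that last_in_set by blast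
    then show ?thesis using that(1) by (simp add: juxtapose_def Comp_Ident)
  qed
qed

abbreviation spl :: "'a list \<Rightarrow> bool" where
  "spl ws \<equiv> ws \<noteq> [] \<and> set ws \<subseteq> Arr C"

abbreviation out :: "'a list \<Rightarrow> 'o \<times> 'o" where
  "out ws \<equiv> (Dom C (hd ws), Cod C (last ws))"

lemma plug_arrows_typed:
  "spl ws \<Longrightarrow> \<forall>u \<in> set us. spl u \<Longrightarrow> map out us = spliced_ins C ws \<Longrightarrow>
    spl (plug_arrows C ws us) \<and> out (plug_arrows C ws us) = out ws \<and>
    spliced_ins C (plug_arrows C ws us) = concat (map (spliced_ins C) us)"
proof (induction ws arbitrary: us rule: induct_list012)
  case (2 w)
  then show ?case by simp
next
  case (3 w w' ws)
  from 3(5) obtain u us' where us: "us = u # us'" "out u = (Cod C w, Dom C w')"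
      "map out us' = spliced_ins C (w' # ws)"
    by auto
  let ?r = "plug_arrows C (w' # ws) us'"
  have r: "spl ?r" "out ?r = out (w' # ws)" "spliced_ins C ?r = concat (map (spliced_ins C) us')"
    using 3(2)[of us'] 3(3,4) us by auto
  let ?j = "juxtapose C u ?r"
  have j: "spl ?j" "out ?j = (Dom C (hd u), Cod C (last ?r))"
      "spliced_ins C ?j = spliced_ins C u @ spliced_ins C ?r"
    using juxtapose_typed[of ?r u] r us 3(4) by auto
  show ?case
    using juxtapose_typed[of ?j "[w]"] j r us 3(3) by auto
qed simp

lemma plug_arrows_juxtapose:
  assumes "spl y" "\<forall>u \<in> set vs. spl u" "map out vs = spliced_ins C y"
  shows "spl x \<Longrightarrow> Cod C (last x) = Dom C (hd y) \<Longrightarrow> \<forall>u \<in> set us. spl u \<Longrightarrow>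
    map out us = spliced_ins C x \<Longrightarrow>
    plug_arrows C (juxtapose C x y) (us @ vs) =
      juxtapose C (plug_arrows C x us) (plug_arrows C y vs)"
proof (induction x arbitrary: us rule: induct_list012)
  case (2 w)
  obtain z y' where y: "y = z # y'" using assms(1) by (cases y) auto
  show ?case
  proof (cases vs)
    case Nil
    then show ?thesis using 2 y by simp
  next
    case (Cons v vs')
    then obtain z' y'' where y': "y' = z' # y''" using assms(3) y by (cases y') auto
    let ?r = "plug_arrows C y' vs'"
    have "spl ?r" "Dom C (hd ?r) = Dom C z'"
      using plug_arrows_typed[of y' vs'] assms y y' Cons by auto
    moreover have "spl v" "out v = (Cod C z, Dom C z')"
      using assms y y' Cons by auto
    ultimately have "spl (juxtapose C v ?r)" "Dom C (hd (juxtapose C v ?r)) = Cod C z"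
      using juxtapose_typed[of ?r v] by auto
    then show ?thesis using 2 y Cons assms(1)
      using juxtapose_assoc[of "[z]" "juxtapose C v ?r" "[w]"] by simp
  qed
next
  case (3 w w' x)
  from 3(6) obtain u us' where us: "us = u # us'" "out u = (Cod C w, Dom C w')"
      "map out us' = spliced_ins C (w' # x)"
    by auto
  let ?r = "plug_arrows C (w' # x) us'" and ?s = "plug_arrows C y vs"
  have r: "spl ?r" "out ?r = out (w' # x)"
    using plug_arrows_typed[of "w' # x" us'] 3(3,5) us by auto
  have s: "spl ?s" "out ?s = out y"
    using plug_arrows_typed[of y vs] assms by auto
  have u: "spl u" using us 3(5) by simp
  have rs: "Cod C (last ?r) = Dom C (hd ?s)" using r s 3(4) by simp
  have ur: "Cod C (last u) = Dom C (hd ?r)" using r us by simp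
  have IH: "plug_arrows C (juxtapose C (w' # x) y) (us' @ vs) = juxtapose C ?r ?s"
    using 3(2)[of us'] 3(3,4,5) us by simp
  have j: "spl (juxtapose C u ?r)" "out (juxtapose C u ?r) = (Dom C (hd u), Cod C (last ?r))"
    using juxtapose_typed[of ?r u] r u ur by auto
  have "plug_arrows C (juxtapose C (w # w' # x) y) (us @ vs)
      = juxtapose C [w] (juxtapose C u (juxtapose C ?r ?s))"
    using IH us by simp
  also have "\<dots> = juxtapose C [w] (juxtapose C (juxtapose C u ?r) ?s)"
    using juxtapose_assoc[of ?r ?s u] r s u rs ur by simp
  also have "\<dots> = juxtapose C (juxtapose C [w] (juxtapose C u ?r)) ?s"
    using juxtapose_assoc[of "juxtapose C u ?r" ?s "[w]"] j s rs us 3(3) by simp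
  finally show ?case using us by simp
qed simp

lemma plug_arrows_assoc:
  "spl ws \<Longrightarrow> \<forall>u \<in> set us. spl u \<Longrightarrow> map out us = spliced_ins C ws \<Longrightarrow>
    list_all2 (\<lambda>u hs. (\<forall>h \<in> set hs. spl h) \<and> map out hs = spliced_ins C u) us hss \<Longrightarrow>
    plug_arrows C (plug_arrows C ws us) (concat hss) =
      plug_arrows C ws (map2 (plug_arrows C) us hss)"
proof (induction ws arbitrary: us hss rule: induct_list012)
  case (2 w)
  then show ?case by simp
next
  case (3 w w' ws)
  from 3(5) obtain u us' where us: "us = u # us'" "out u = (Cod C w, Dom C w')"
      "map out us' = spliced_ins C (w' # ws)"
    by auto
  from 3(6) us obtain hs hss' where hss: "hss = hs # hss'"
      "\<forall>h \<in> set hs. spl h" "map out hs = spliced_ins C u"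
      "list_all2 (\<lambda>u hs. (\<forall>h \<in> set hs. spl h) \<and> map out hs = spliced_ins C u) us' hss'"
    by (auto simp: list_all2_Cons1)
  let ?r = "plug_arrows C (w' # ws) us'"
  have r: "spl ?r" "out ?r = out (w' # ws)" "spliced_ins C ?r = concat (map (spliced_ins C) us')"
    using plug_arrows_typed[of "w' # ws" us'] 3(3,4) us by auto
  have u: "spl u" using us 3(4) by simp
  have ur: "Cod C (last u) = Dom C (hd ?r)" using r us by simp
  have j: "spl (juxtapose C u ?r)" "out (juxtapose C u ?r) = (Dom C (hd u), Cod C (last ?r))"
      "spliced_ins C (juxtapose C u ?r) = spliced_ins C u @ spliced_ins C ?r"
    using juxtapose_typed[of ?r u] r u ur by auto
  have c: "\<forall>h \<in> set (concat hss'). spl h" "map out (concat hss') = concat (map (spliced_ins C) us')"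
    using hss(4) by (induction rule: list_all2_induct) auto
  have "plug_arrows C (plug_arrows C (w # w' # ws) us) (concat hss)
      = plug_arrows C (juxtapose C [w] (juxtapose C u ?r)) ([] @ (hs @ concat hss'))"
    using us hss by simp
  also have "\<dots> = juxtapose C (plug_arrows C [w] []) (plug_arrows C (juxtapose C u ?r) (hs @ concat hss'))"
  proof (rule plug_arrows_juxtapose)
    show "\<forall>h \<in> set (hs @ concat hss'). spl h" using c(1) hss(2) by auto
    show "map out (hs @ concat hss') = spliced_ins C (juxtapose C u ?r)"
      unfolding j(3) r(3) map_append c(2) hss(3) ..
  qed (use j us 3(3) in auto)
  also have "plug_arrows C (juxtapose C u ?r) (hs @ concat hss')
      = juxtapose C (plug_arrows C u hs) (plug_arrows C ?r (concat hss'))"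
    using r c u ur hss(2,3) by (intro plug_arrows_juxtapose) auto
  also have "plug_arrows C ?r (concat hss') = plug_arrows C (w' # ws) (map2 (plug_arrows C) us' hss')"
    using 3(2)[of us' hss'] 3(3,4) us hss(4) by simp
  finally show ?case using us hss by simp
qed simp

lemma operad_Spliced: "operad (Spliced C)"
proof
  fix f assume f: "f \<in> Ops (Spliced C)"
  then have "set (butlast f) \<subseteq> Arr C" "set (tl f) \<subseteq> Arr C"
    by (auto dest: in_set_butlastD list.set_sel(2))
  then have "a \<in> Obj C \<and> b \<in> Obj C" if "(a, b) \<in> set (spliced_ins C f)" for a b
    using set_zip_leftD[OF that] set_zip_rightD[OF that] by (auto simp: Dom_Obj Cod_Obj)
  then show "set (Ins (Spliced C) f) \<subseteq> Colors (Spliced C)"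
    by auto
  show "Out (Spliced C) f \<in> Colors (Spliced C)"
    using f by (simp add: Dom_Obj Cod_Obj subset_iff)
  have "juxtapose C f [Ident C (Cod C (last f))] = f" "juxtapose C [Ident C (Dom C (hd f))] f = f"
    using f by (simp_all add: juxtapose_Ident)
  then show "Plug (Spliced C) (Unit (Spliced C) (Out (Spliced C) f)) [f] = f"
    by simp
  have "plug_arrows C f (map (Unit (Spliced C)) (spliced_ins C f)) = f"
    if "f \<noteq> []" "set f \<subseteq> Arr C" for f
    using that
  proof (induction f rule: induct_list012)
    case (3 w w' ws)
    then show ?case by (simp add: Comp_Ident Ident_Comp)
  qed simp_all
  then show "Plug (Spliced C) f (map (Unit (Spliced C)) (Ins (Spliced C) f)) = f"
    using f by simp
next
  fix c assume "c \<in> Colors (Spliced C)"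
  then show "Unit (Spliced C) c \<in> Ops (Spliced C)" "Ins (Spliced C) (Unit (Spliced C) c) = [c]"
    "Out (Spliced C) (Unit (Spliced C) c) = c"
    by (auto simp: Ident_Arr Dom_Ident Cod_Ident)
next
  fix f gs assume "pluggable (Spliced C) f gs"
  then have "spl f" "\<forall>g \<in> set gs. spl g" "map out gs = spliced_ins C f"
    by (auto simp: pluggable_def Spliced_def)
  note p = plug_arrows_typed[OF this]
  show "Plug (Spliced C) f gs \<in> Ops (Spliced C)"
    "Out (Spliced C) (Plug (Spliced C) f gs) = Out (Spliced C) f"
    "Ins (Spliced C) (Plug (Spliced C) f gs) = concat (map (Ins (Spliced C)) gs)"
    using p by (simp_all add: Spliced_def)
next
  fix f gs hss
  assume p: "pluggable (Spliced C) f gs" and ps: "list_all2 (pluggable (Spliced C)) gs hss"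
  have "spl f" "\<forall>g \<in> set gs. spl g" "map out gs = spliced_ins C f"
    using p by (auto simp: pluggable_def Spliced_def)
  moreover have "list_all2 (\<lambda>u hs. (\<forall>h \<in> set hs. spl h) \<and> map out hs = spliced_ins C u) gs hss"
    using ps by (rule list_all2_mono) (auto simp: pluggable_def Spliced_def)
  ultimately show "Plug (Spliced C) (Plug (Spliced C) f gs) (concat hss)
      = Plug (Spliced C) f (map2 (Plug (Spliced C)) gs hss)"
    using plug_arrows_assoc[of f gs hss] by simp
qed

lemma constants_Spliced:
  "constants (Spliced C) (A, B) = (\<lambda>w. [w]) ` {w \<in> Arr C. Dom C w = A \<and> Cod C w = B}"
proof -
  have "spliced_ins C ws = [] \<longleftrightarrow> (\<exists>w. ws = [w])" if "ws \<noteq> []" for ws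
    using that by (cases ws rule: remdups_adj.cases) simp_all
  then have "ws \<in> constants (Spliced C) (A, B) \<longleftrightarrow>
      (\<exists>w. ws = [w] \<and> w \<in> Arr C \<and> Dom C w = A \<and> Cod C w = B)" for ws
    unfolding constants_def Spliced_simps mem_Collect_eq by force
  then show ?thesis by blast
qed

lemma spliced_composite_eq:
  "spl ws \<Longrightarrow> length us = length (spliced_ins C ws) \<Longrightarrow>
    plug_arrows C ws (map (\<lambda>u. [u]) us) = [spliced_composite C ws us]"
proof (induction ws arbitrary: us rule: induct_list012)
  case (3 w w' ws)
  then show ?case by (cases us) simp_all
qed simp_all

end

subsection \<open>Independence of the types of colors and nodes\<close>

lemma operad_functor_comp:
  assumes F: "operad_functor P Q pc pm" and G: "operad_functor Q R qc qm"
  shows "operad_functor P R (qc \<circ> pc) (qm \<circ> pm)"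
proof -
  have c: "pc c \<in> Colors Q" "pm (Unit P c) = Unit Q (pc c)" if "c \<in> Colors P" for c
    using F that unfolding operad_functor_def by blast+
  have c': "qc c \<in> Colors R" "qm (Unit Q c) = Unit R (qc c)" if "c \<in> Colors Q" for c
    using G that unfolding operad_functor_def by blast+
  have m: "pm f \<in> Ops Q" "Ins Q (pm f) = map pc (Ins P f)" "Out Q (pm f) = pc (Out P f)"
    if "f \<in> Ops P" for f
    using F that unfolding operad_functor_def by blast+
  have m': "qm f \<in> Ops R" "Ins R (qm f) = map qc (Ins Q f)" "Out R (qm f) = qc (Out Q f)"
    if "f \<in> Ops Q" for f
    using G that unfolding operad_functor_def by blast+
  have plug: "qm (pm (Plug P f gs)) = Plug R (qm (pm f)) (map (qm \<circ> pm) gs)"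
    if p: "pluggable P f gs" for f gs
  proof -
    have f: "f \<in> Ops P" and gs: "set gs \<subseteq> Ops P" and o: "map (Out P) gs = Ins P f"
      using p unfolding pluggable_def by blast+
    have "map (Out Q) (map pm gs) = map pc (map (Out P) gs)"
      unfolding map_map by (intro map_cong) (use gs m in auto)
    then have "map (Out Q) (map pm gs) = Ins Q (pm f)"
      unfolding o m(2)[OF f] .
    moreover have "set (map pm gs) \<subseteq> Ops Q"
      using gs m(1) by auto
    ultimately have "pluggable Q (pm f) (map pm gs)"
      unfolding pluggable_def using m(1)[OF f] by blast
    then have "qm (Plug Q (pm f) (map pm gs)) = Plug R (qm (pm f)) (map qm (map pm gs))"
      using G unfolding operad_functor_def by blast
    moreover have "pm (Plug P f gs) = Plug Q (pm f) (map pm gs)"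
      using F p unfolding operad_functor_def by blast
    ultimately show ?thesis by simp
  qed
  show ?thesis
    unfolding operad_functor_def using c c' m m' plug by simp
qed

lemma holes_map_tree: "holes (map_tree h k t) = map h (holes t)"
  by (induction t) (simp_all add: map_concat comp_def cong: map_cong)

lemma graft_map_tree:
  "length us = length (holes t) \<Longrightarrow>
    map_tree h k (graft t us) = graft (map_tree h k t) (map (map_tree h k) us)"
  "length us = length (concat (map holes ts)) \<Longrightarrow>
    map (map_tree h k) (grafts ts us) = grafts (map (map_tree h k) ts) (map (map_tree h k) us)"
proof (induction t us and ts us rule: graft_grafts.induct)
  case (1 c us)
  then show ?case by (cases us) simp_all
qed (simp_all add: holes_map_tree take_map drop_map)

lemma operad_functor_map_tree:
  assumes "species S" "\<forall>c \<in> SColors S. h c \<in> SColors T"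
    and v: "\<forall>v \<in> Nodes S. k v \<in> Nodes T \<and> NIn T (k v) = map h (NIn S v) \<and> NOut T (k v) = h (NOut S v)"
  shows "operad_functor (Free S) (Free T) h (map_tree h k)"
proof -
  have r: "tree_root T (map_tree h k t) = h (tree_root S t)" if "well_typed S t" for t
    using that v by (cases t) simp_all
  have w: "well_typed T (map_tree h k t)" if "well_typed S t" for t
    using that
  proof (induction t)
    case (Hole c)
    then show ?case using assms(2) by simp
  next
    case (Node u ts)
    have "map (tree_root T) (map (map_tree h k) ts) = map h (map (tree_root S) ts)"
      unfolding map_map by (rule map_cong) (use Node.prems r in auto)
    also have "\<dots> = NIn T (k u)"
      using Node.prems v by simp
    finally show ?case using Node v by (simp del: map_map)
  qed
  have g: "map_tree h k (graft t us) = graft (map_tree h k t) (map (map_tree h k) us)"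
    if "map (tree_root S) us = holes t" for t us
    using arg_cong[OF that, of length] by (simp add: graft_map_tree)
  show ?thesis
    unfolding operad_functor_def
    using assms(2) r w g by (auto simp: pluggable_def holes_map_tree)
qed

lemma context_free_languageI:
  fixes G :: "('o, 'a, 'c, 'v) grammar"
  assumes G: "context_free_grammar G" and "PCol G (Start G) = (A, B)"
  shows "context_free_language (Base G) A B (language G)"
proof -
  let ?S = "Spec G"
  have fin: "finite (SColors ?S)" "finite (Nodes ?S)" and S: "species ?S"
    using G by (auto simp: context_free_grammar_def finite_species_def)
  obtain f :: "'c \<Rightarrow> nat" where f: "inj_on f (SColors ?S)"
    using finite_imp_inj_to_nat_seg[OF fin(1)] by blast
  obtain g :: "'v \<Rightarrow> nat" where g: "inj_on g (Nodes ?S)"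
    using finite_imp_inj_to_nat_seg[OF fin(2)] by blast
  define f' where "f' = inv_into (SColors ?S) f"
  define g' where "g' = inv_into (Nodes ?S) g"
  have f': "f' (f c) = c" if "c \<in> SColors ?S" for c using that f by (simp add: f'_def)
  have g': "g' (g v) = v" if "v \<in> Nodes ?S" for v using that g by (simp add: g'_def)
  define T where "T = \<lparr>SColors = f ` SColors ?S, Nodes = g ` Nodes ?S,
    NIn = (\<lambda>n. map f (NIn ?S (g' n))), NOut = (\<lambda>n. f (NOut ?S (g' n)))\<rparr>"
  have T: "finite_species T"
    using S fin by (auto simp: T_def finite_species_def species_def g')
  then have sT: "species T" by (simp add: finite_species_def)
  have F: "operad_functor (Free ?S) (Free T) f (map_tree f g)"
    by (rule operad_functor_map_tree[OF S]) (auto simp: T_def g')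
  have n: "map (f' \<circ> f) (NIn ?S v) = NIn ?S v" "f' (f (NOut ?S v)) = NOut ?S v"
    if "v \<in> Nodes ?S" for v
    using that S by (auto simp: species_def f' subset_iff intro!: map_idI)
  have F': "operad_functor (Free T) (Free ?S) f' (map_tree f' g')"
    by (rule operad_functor_map_tree[OF sT]) (auto simp: T_def f' g' n)
  define G' :: "('o, 'a, nat, nat) grammar" where
    "G' = \<lparr>Base = Base G, Spec = T, Start = f (Start G), PCol = PCol G \<circ> f', POp = POp G \<circ> map_tree f' g'\<rparr>"
  have "operad_functor (Free ?S) (Spliced (Base G)) (PCol G) (POp G)" and st: "Start G \<in> SColors ?S"
    using G by (simp_all add: context_free_grammar_def)
  from operad_functor_comp[OF F' this(1)] have "context_free_grammar G'"
    using G T by (simp add: context_free_grammar_def G'_def T_def)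
  moreover have "PCol G' (Start G') = (A, B)"
    using assms(2) st by (simp add: G'_def f')
  moreover have "language G' = language G"
  proof -
    have id: "map_tree f' g' (map_tree f g t) = t" if "well_typed ?S t" for t
      using that
    proof (induction t)
      case (Node v ts)
      then have "map (map_tree f' g' \<circ> map_tree f g) ts = ts" by (intro map_idI) simp
      with Node.prems show ?case by (simp add: g')
    qed (simp add: f')
    have a: "map_tree f g t \<in> constants (Free T) (f (Start G))"
      if "t \<in> constants (Free ?S) (Start G)" for t
      using that F by (auto simp: constants_def operad_functor_def)
    have b: "map_tree f' g' t \<in> constants (Free ?S) (Start G)"
      if "t \<in> constants (Free T) (f (Start G))" for t
      using that F' st by (auto simp: constants_def operad_functor_def f')
    have "map_tree f' g' ` constants (Free T) (f (Start G)) = constants (Free ?S) (Start G)"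
    proof
      show "constants (Free ?S) (Start G) \<subseteq> map_tree f' g' ` constants (Free T) (f (Start G))"
      proof
        fix t assume t: "t \<in> constants (Free ?S) (Start G)"
        then have "t = map_tree f' g' (map_tree f g t)" by (simp add: id constants_def)
        with a[OF t] show "t \<in> map_tree f' g' ` constants (Free T) (f (Start G))" by (rule rev_image_eqI)
      qed
    qed (use b in auto)
    then have "(POp G \<circ> map_tree f' g') ` constants (Free T) (f (Start G))
        = POp G ` constants (Free ?S) (Start G)"
      by (simp only: image_comp[symmetric])
    then show ?thesis by (simp only: language_def G'_def grammar.simps)
  qed
  moreover have "Base G' = Base G"
    by (simp add: G'_def)
  ultimately show ?thesis
    unfolding context_free_language_def by blast
qed

end

theory Submission
  imports Defs
begin

text \<open>Unions and spliced concatenations are instances of one construction: to the disjoint union of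
  the species of grammars \<open>G\<^sub>0, G\<^sub>1, \<dots>\<close> add a fresh start color and, for each rule consisting of
  a spliced arrow \<open>ws\<close> and indices \<open>j\<^sub>1, \<dots>, j\<^sub>n\<close>, a node into the fresh color with the start colors
  of the \<open>G\<^sub>j\<close> as inputs, sent to \<open>ws\<close>. A constant of the fresh color is such a node
  applied to constants of the \<open>G\<^sub>j\<close>, because a tree whose root color comes from \<open>G\<^sub>j\<close> consists of nodes
  of \<open>G\<^sub>j\<close>. The union uses two rules with the spliced arrow \<open>id-id\<close>, the spliced concatenation a single
  rule. The functorial image is obtained by composing with the functor of operads that \<open>F\<close> induces
  between operads of spliced arrows.\<close>

section \<open>Grammars and their evaluation\<close>

text \<open>Serves to evaluate a relabelled component tree inside the combined grammar.\<close>

lemma free_extension_map_tree: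
  "free_extension P pc pn (map_tree h k t) =
    free_extension P (\<lambda>c. pc (h c)) (\<lambda>v. pn (k v)) t"
proof (induction t)
  case (Node v ts)
  then have "map (free_extension P pc pn) (map (map_tree h k) ts)
      = map (free_extension P (\<lambda>c. pc (h c)) (\<lambda>v. pn (k v))) ts"
    by simp
  then show ?case by (simp del: map_map)
qed simp

text \<open>By uniqueness in the universal property of the free operad, the functor of a grammar is
  determined by its values on corollas. In this form it can be compared with the combined functor,
  which is built as a free extension.\<close>

lemma POp_eq_free_extension:
  assumes "context_free_grammar G" "well_typed (Spec G) t"
  shows "POp G t =
    free_extension (Spliced (Base G)) (PCol G) (\<lambda>v. POp G (corolla (Spec G) v)) t"
  using assms
  by (intro operad_functor_Free_unique[of "Spec G"])
    (auto simp: context_free_grammar_def finite_species_def)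

lemma operad_functor_constants:
  assumes "operad_functor P Q pc pm" "f \<in> constants P c"
  shows "pm f \<in> constants Q (pc c)"
  using assms by (auto simp: operad_functor_def constants_def)

text \<open>Operad functors preserve constants, and the constants among spliced arrows are the
  one-element lists.\<close>

lemma POp_constant:
  assumes G: "context_free_grammar G" and "t \<in> constants (Free (Spec G)) (Start G)"
  obtains u where "POp G t = [u]" "u \<in> language G" "u \<in> Arr (Base G)"
    "Dom (Base G) u = fst (PCol G (Start G))" "Cod (Base G) u = snd (PCol G (Start G))"
proof -
  have "operad_functor (Free (Spec G)) (Spliced (Base G)) (PCol G) (POp G)"
    and C: "category (Base G)"
    using G by (simp_all add: context_free_grammar_def)
  from operad_functor_constants[OF this(1) assms(2)]
  have "POp G t \<in> constants (Spliced (Base G)) (fst (PCol G (Start G)), snd (PCol G (Start G)))"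
    by simp
  then obtain u where u: "POp G t = [u]" "u \<in> Arr (Base G)"
    "Dom (Base G) u = fst (PCol G (Start G))" "Cod (Base G) u = snd (PCol G (Start G))"
    unfolding category.constants_Spliced[OF C] by blast
  then have "u \<in> language G"
    using assms(2) by (auto simp: language_def intro: rev_image_eqI)
  with u that show thesis by blast
qed

text \<open>The definition of \<open>language\<close> only collects values of the form
  \<open>[w]\<close>; since every constant has such a value, nothing is lost.\<close>

lemma POp_constants:
  assumes G: "context_free_grammar G"
  shows "POp G ` constants (Free (Spec G)) (Start G) = (\<lambda>u. [u]) ` language G"
proof
  show "POp G ` constants (Free (Spec G)) (Start G) \<subseteq> (\<lambda>u. [u]) ` language G"
    by (blast elim: POp_constant[OF G])
  show "(\<lambda>u. [u]) ` language G \<subseteq> POp G ` constants (Free (Spec G)) (Start G)"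
    by (auto simp: language_def)
qed

lemma language_Arr:
  assumes G: "context_free_grammar G" and w: "w \<in> language G"
  shows "w \<in> Arr (Base G)"
    "Dom (Base G) w = fst (PCol G (Start G))" "Cod (Base G) w = snd (PCol G (Start G))"
proof -
  obtain t where t: "t \<in> constants (Free (Spec G)) (Start G)" "[w] = POp G t"
    using w by (auto simp: language_def)
  from POp_constant[OF G t(1)] obtain u where "POp G t = [u]" "u \<in> Arr (Base G)"
    "Dom (Base G) u = fst (PCol G (Start G))" "Cod (Base G) u = snd (PCol G (Start G))"
    by blast
  with t(2) show "w \<in> Arr (Base G)"
    "Dom (Base G) w = fst (PCol G (Start G))" "Cod (Base G) w = snd (PCol G (Start G))"
    by simp_all
qed

section \<open>Combining grammars by spliced rules\<close>

text \<open>A rule refers to grammars by position in \<open>Gs\<close>, so it may use one several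
  times or not at all. \<open>A\<close> and \<open>B\<close> are required to be objects separately
  because an empty \<open>R\<close> would not force it.\<close>

locale spliced_rules = category C for C :: "('o, 'a) category" +
  fixes Gs :: "('o, 'a, 'c, 'v) grammar list"
    and R :: "('a list \<times> nat list) set"
    and A B :: 'o
  assumes fin_gen: "finitely_generated C"
    and AB: "A \<in> Obj C" "B \<in> Obj C"
    and grammars: "i < length Gs \<Longrightarrow> context_free_grammar (Gs ! i) \<and> Base (Gs ! i) = C"
    and finite_R: "finite R"
    and rules: "(ws, js) \<in> R \<Longrightarrow> spl ws \<and> out ws = (A, B) \<and> (\<forall>j \<in> set js. j < length Gs) \<and>
      spliced_ins C ws = map (\<lambda>j. PCol (Gs ! j) (Start (Gs ! j))) js"
begin

text \<open>\<open>None\<close> is the fresh start color, tags keep the copies of the species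
  disjoint, and each rule is its own node. No node has \<open>None\<close> among its inputs, so rule
  nodes occur only at the root of a well-typed tree.\<close>

definition sum_species :: "((nat \<times> 'c) option, ('a list \<times> nat list) + nat \<times> 'v) species" where
  "sum_species =
    \<lparr>SColors = insert None (Some ` (SIGMA i : {..<length Gs}. SColors (Spec (Gs ! i)))),
     Nodes = Inl ` R \<union> Inr ` (SIGMA i : {..<length Gs}. Nodes (Spec (Gs ! i))),
     NIn = case_sum (\<lambda>(ws, js). map (\<lambda>j. Some (j, Start (Gs ! j))) js)
       (\<lambda>(i, v). map (\<lambda>c. Some (i, c)) (NIn (Spec (Gs ! i)) v)),
     NOut = case_sum (\<lambda>_. None) (\<lambda>(i, v). Some (i, NOut (Spec (Gs ! i)) v))\<rparr>"

definition sum_color :: "(nat \<times> 'c) option \<Rightarrow> 'o \<times> 'o" where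
  "sum_color = case_option (A, B) (\<lambda>(i, c). PCol (Gs ! i) c)"

text \<open>A grammar supplies a functor on trees; the value of a single node is recovered from its
  corolla.\<close>

definition sum_node :: "('a list \<times> nat list) + nat \<times> 'v \<Rightarrow> 'a list" where
  "sum_node = case_sum fst (\<lambda>(i, v). POp (Gs ! i) (corolla (Spec (Gs ! i)) v))"

definition sum_grammar where
  "sum_grammar = \<lparr>Base = C, Spec = sum_species, Start = None, PCol = sum_color,
    POp = free_extension (Spliced C) sum_color sum_node\<rparr>"

definition inj_tree :: "nat \<Rightarrow> ('c, 'v) tree \<Rightarrow>
    ((nat \<times> 'c) option, ('a list \<times> nat list) + nat \<times> 'v) tree" where
  "inj_tree i = map_tree (\<lambda>c. Some (i, c)) (\<lambda>v. Inr (i, v))"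

section \<open>Well-formedness of the combined grammar\<close>

lemma grammarD:
  assumes "i < length Gs"
  shows "species (Spec (Gs ! i))" "finite_species (Spec (Gs ! i))"
    "Start (Gs ! i) \<in> SColors (Spec (Gs ! i))" "Base (Gs ! i) = C"
    "operad_functor (Free (Spec (Gs ! i))) (Spliced C) (PCol (Gs ! i)) (POp (Gs ! i))"
  using grammars[OF assms] by (auto simp: context_free_grammar_def finite_species_def)

lemma finite_sum_species: "finite_species sum_species"
  unfolding finite_species_def
proof (intro conjI)
  show "species sum_species"
    unfolding species_def
  proof
    fix x assume "x \<in> Nodes sum_species"
    then consider ws js where "x = Inl (ws, js)" "(ws, js) \<in> R"
      | i v where "x = Inr (i, v)" "i < length Gs" "v \<in> Nodes (Spec (Gs ! i))"
      by (auto simp: sum_species_def)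
    then show "set (NIn sum_species x) \<subseteq> SColors sum_species \<and>
      NOut sum_species x \<in> SColors sum_species"
    proof cases
      case 1
      have "\<forall>j \<in> set js. j < length Gs" using rules[OF 1(2)] by blast
      then show ?thesis using grammarD(3) 1(1) by (auto simp: sum_species_def)
    next
      case 2
      then show ?thesis using grammarD(1)[OF 2(2)] by (auto simp: sum_species_def species_def)
    qed
  qed
  show "finite (SColors sum_species)" "finite (Nodes sum_species)"
    using grammarD(2) finite_R
    by (auto simp: sum_species_def finite_species_def intro!: finite_imageI finite_SigmaI)
qed

lemma sum_color_Colors: "\<forall>c \<in> SColors sum_species. sum_color c \<in> Colors (Spliced C)"
proof -
  have "PCol (Gs ! i) c \<in> Obj C \<times> Obj C" if "i < length Gs" "c \<in> SColors (Spec (Gs ! i))" for i c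
    using grammarD(5)[OF that(1)] that(2) by (simp add: operad_functor_def)
  then show ?thesis
    using AB by (auto simp: sum_species_def sum_color_def simp del: mem_Times_iff)
qed

text \<open>The typing condition of the universal property: for rule nodes it is the assumption
  \<open>rules\<close>, for component nodes it holds because the functor of the component preserves
  the type of a corolla.\<close>

lemma sum_node_Ops:
  "\<forall>v \<in> Nodes sum_species. sum_node v \<in> Ops (Spliced C) \<and>
    Ins (Spliced C) (sum_node v) = map sum_color (NIn sum_species v) \<and>
    Out (Spliced C) (sum_node v) = sum_color (NOut sum_species v)"
proof
  fix x assume x: "x \<in> Nodes sum_species"
  then consider ws js where "x = Inl (ws, js)" "(ws, js) \<in> R"
    | i v where "x = Inr (i, v)" "i < length Gs" "v \<in> Nodes (Spec (Gs ! i))"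
    by (auto simp: sum_species_def)
  then show "sum_node x \<in> Ops (Spliced C) \<and>
    Ins (Spliced C) (sum_node x) = map sum_color (NIn sum_species x) \<and>
    Out (Spliced C) (sum_node x) = sum_color (NOut sum_species x)"
  proof cases
    case 1
    have "sum_node x = ws" "sum_color (NOut sum_species x) = (A, B)"
      "map sum_color (NIn sum_species x) = map (\<lambda>j. PCol (Gs ! j) (Start (Gs ! j))) js"
      by (simp_all add: 1(1) sum_species_def sum_node_def sum_color_def)
    moreover have "spl ws" "out ws = (A, B)"
      "spliced_ins C ws = map (\<lambda>j. PCol (Gs ! j) (Start (Gs ! j))) js"
      using rules[OF 1(2)] by blast+
    ultimately show ?thesis
      unfolding Spliced_simps by (simp only: mem_Collect_eq simp_thms)
  next
    case 2
    let ?t = "corolla (Spec (Gs ! i)) v"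
    have "well_typed (Spec (Gs ! i)) ?t"
      by (rule well_typed_corolla[OF grammarD(1)[OF 2(2)] 2(3)])
    then have "POp (Gs ! i) ?t \<in> Ops (Spliced C) \<and>
      Ins (Spliced C) (POp (Gs ! i) ?t) = map (PCol (Gs ! i)) (holes ?t) \<and>
      Out (Spliced C) (POp (Gs ! i) ?t) = PCol (Gs ! i) (tree_root (Spec (Gs ! i)) ?t)"
      using grammarD(5)[OF 2(2)] unfolding operad_functor_def by simp
    moreover have "holes ?t = NIn (Spec (Gs ! i)) v"
      by (simp add: corolla_def comp_def)
    moreover have "tree_root (Spec (Gs ! i)) ?t = NOut (Spec (Gs ! i)) v"
      by (simp add: corolla_def)
    moreover have "sum_node x = POp (Gs ! i) ?t"
      "sum_color (NOut sum_species x) = PCol (Gs ! i) (NOut (Spec (Gs ! i)) v)"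
      "map sum_color (NIn sum_species x) = map (PCol (Gs ! i)) (NIn (Spec (Gs ! i)) v)"
      by (simp_all add: 2(1) sum_species_def sum_node_def sum_color_def)
    ultimately show ?thesis by metis
  qed
qed

text \<open>Functoriality is the existence half of the universal property of the free
  operad.\<close>

lemma context_free_sum_grammar: "context_free_grammar sum_grammar"
proof -
  have "species sum_species"
    using finite_sum_species by (simp add: finite_species_def)
  note operad_functor_extend(1)[OF operad_Spliced this sum_color_Colors sum_node_Ops]
  moreover have "None \<in> SColors sum_species"
    by (simp add: sum_species_def)
  ultimately show ?thesis
    using finite_sum_species fin_gen category_axioms
    by (simp add: context_free_grammar_def sum_grammar_def)
qed

section \<open>Trees lying in a single component\<close>

lemma inj_tree_constants:
  assumes "i < length Gs" "t \<in> constants (Free (Spec (Gs ! i))) c"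
  shows "inj_tree i t \<in> constants (Free sum_species) (Some (i, c))"
proof -
  \<comment> \<open>Tagging is a map of species, hence induces a functor of free operads, and such
    functors preserve constants.\<close>
  have "operad_functor (Free (Spec (Gs ! i))) (Free sum_species) (\<lambda>c. Some (i, c)) (inj_tree i)"
    unfolding inj_tree_def
    by (rule operad_functor_map_tree) (use assms(1) grammarD(1) in \<open>auto simp: sum_species_def\<close>)
  from operad_functor_constants[OF this assms(2)] show ?thesis .
qed

text \<open>A node with output tagged \<open>i\<close> is a copy of a node of \<open>Gs ! i\<close>,
  and its inputs carry the same tag, so the tag spreads from the root to the whole tree.\<close>

lemma tree_from_component:
  assumes "well_typed sum_species t" "tree_root sum_species t = Some (i, c)"
  shows "\<exists>s. well_typed (Spec (Gs ! i)) s \<and> tree_root (Spec (Gs ! i)) s = c \<and> t = inj_tree i s"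
  using assms
proof (induction t arbitrary: c)
  case (Hole x)
  then show ?case
    by (intro exI[of _ "Hole c"]) (auto simp: sum_species_def inj_tree_def)
next
  case (Node x ts)
  then obtain v where v: "x = Inr (i, v)" "v \<in> Nodes (Spec (Gs ! i))"
      "NOut (Spec (Gs ! i)) v = c"
    by (auto simp: sum_species_def)
  have r: "map (tree_root sum_species) ts = map (\<lambda>c. Some (i, c)) (NIn (Spec (Gs ! i)) v)"
    using Node.prems(1) v(1) by (simp add: sum_species_def)
  then have len: "length ts = length (NIn (Spec (Gs ! i)) v)"
    by (metis length_map)
  \<comment> \<open>The argument goes position by position because each subtree has its own expected
    root color; the preimages are then chosen as a function of the position and reassembled into
    \<open>?ss\<close>.\<close>
  have "\<exists>s. well_typed (Spec (Gs ! i)) s \<and> tree_root (Spec (Gs ! i)) s = NIn (Spec (Gs ! i)) v ! n \<and>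
      ts ! n = inj_tree i s" if "n < length ts" for n
  proof (rule Node.IH)
    show "ts ! n \<in> set ts" "well_typed sum_species (ts ! n)"
      using that Node.prems(1) by simp_all
    show "tree_root sum_species (ts ! n) = Some (i, NIn (Spec (Gs ! i)) v ! n)"
      using arg_cong[OF r, of "\<lambda>xs. xs ! n"] that len by simp
  qed
  then obtain s where s: "well_typed (Spec (Gs ! i)) (s n)"
    "tree_root (Spec (Gs ! i)) (s n) = NIn (Spec (Gs ! i)) v ! n" "ts ! n = inj_tree i (s n)"
    if "n < length ts" for n
    by metis
  let ?ss = "map s [0..<length ts]"
  have "map (inj_tree i) ?ss = ts" "map (tree_root (Spec (Gs ! i))) ?ss = NIn (Spec (Gs ! i)) v"
    using s len by (auto intro!: nth_equalityI)
  moreover from this v(2,3) s(1) have "well_typed (Spec (Gs ! i)) (Node v ?ss) \<and>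
      tree_root (Spec (Gs ! i)) (Node v ?ss) = c"
    by (simp del: map_map)
  moreover have "inj_tree i (Node v us) = Node (Inr (i, v)) (map (inj_tree i) us)" for us
    by (simp add: inj_tree_def)
  ultimately show ?case
    unfolding v(1) by metis
qed

lemma component_constant:
  assumes "t \<in> constants (Free sum_species) (Some (i, c))"
  obtains s where "s \<in> constants (Free (Spec (Gs ! i))) c" "t = inj_tree i s"
proof -
  have "well_typed sum_species t" "tree_root sum_species t = Some (i, c)" and h: "holes t = []"
    using assms by (simp_all add: constants_def)
  from tree_from_component[OF this(1,2)] obtain s where
    s: "well_typed (Spec (Gs ! i)) s" "tree_root (Spec (Gs ! i)) s = c" "t = inj_tree i s"
    by blast
  have "holes s = []"
    using h s(3) by (simp add: inj_tree_def holes_map_tree)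
  with s that show thesis
    by (simp add: constants_def)
qed

text \<open>Both sides are free extensions of the same data: on entries tagged \<open>i\<close>,
  \<open>sum_color\<close> and \<open>sum_node\<close> are the color map and the corolla values of
  \<open>Gs ! i\<close>.\<close>

lemma POp_inj_tree:
  assumes "i < length Gs" "well_typed (Spec (Gs ! i)) t"
  shows "POp sum_grammar (inj_tree i t) = POp (Gs ! i) t"
proof -
  have "(\<lambda>c. sum_color (Some (i, c))) = PCol (Gs ! i)"
    "(\<lambda>v. sum_node (Inr (i, v))) = (\<lambda>v. POp (Gs ! i) (corolla (Spec (Gs ! i)) v))"
    by (auto simp: sum_color_def sum_node_def)
  then show ?thesis
    using POp_eq_free_extension[of "Gs ! i" t] grammars[OF assms(1)] assms(2)
    by (simp add: sum_grammar_def inj_tree_def free_extension_map_tree)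
qed

section \<open>The language of the combined grammar\<close>

lemma component_language:
  assumes "i < length Gs"
  shows "POp sum_grammar ` constants (Free sum_species) (Some (i, Start (Gs ! i)))
    = (\<lambda>u. [u]) ` language (Gs ! i)"
proof -
  have G: "context_free_grammar (Gs ! i)" using grammars[OF assms] by simp
  have wt: "well_typed (Spec (Gs ! i)) s" if "s \<in> constants (Free (Spec (Gs ! i))) c" for s c
    using that by (simp add: constants_def)
  \<comment> \<open>\<open>inj_tree i\<close> hits every constant of the tagged start color and
    leaves values unchanged.\<close>
  have "constants (Free sum_species) (Some (i, Start (Gs ! i)))
      = inj_tree i ` constants (Free (Spec (Gs ! i))) (Start (Gs ! i))"
    by (blast intro: inj_tree_constants[OF assms] elim: component_constant)
  then have "POp sum_grammar ` constants (Free sum_species) (Some (i, Start (Gs ! i)))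
      = POp (Gs ! i) ` constants (Free (Spec (Gs ! i))) (Start (Gs ! i))"
    by (simp add: image_image POp_inj_tree[OF assms wt] cong: image_cong_simp)
  also have "\<dots> = (\<lambda>u. [u]) ` language (Gs ! i)"
    by (rule POp_constants[OF G])
  finally show ?thesis .
qed

text \<open>A constant of color \<open>None\<close> is a rule node applied to start constants of the
  components, and evaluating it plugs arrows of their languages into the gaps of the rule.\<close>

lemma language_sum_grammar:
  "language sum_grammar =
    (\<Union>(ws, js) \<in> R. spliced_concatenation C ws (map (\<lambda>j. language (Gs ! j)) js))"
proof -
  let ?e = "POp sum_grammar"
  let ?K = "\<lambda>j. constants (Free sum_species) (Some (j, Start (Gs ! j)))"
  have e: "?e (Node (Inl (ws, js)) ts) = plug_arrows C ws (map ?e ts)" for ws js ts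
    by (simp add: sum_grammar_def sum_node_def)
  \<comment> \<open>The typing of a rule makes its number of gaps equal to the length of
    \<open>js\<close>, as needed to plug every gap.\<close>
  have composite: "plug_arrows C ws (map (\<lambda>u. [u]) us) = [spliced_composite C ws us]"
    if "(ws, js) \<in> R" "length us = length js" for ws js us
  proof -
    have ws: "spl ws" "spliced_ins C ws = map (\<lambda>j. PCol (Gs ! j) (Start (Gs ! j))) js"
      using rules[OF that(1)] by blast+
    from arg_cong[OF ws(2), of length] have "length us = length (spliced_ins C ws)"
      using that(2) by simp
    from spliced_composite_eq[OF ws(1) this] show ?thesis .
  qed
  have K: "Node (Inl (ws, js)) ts \<in> constants (Free sum_species) None \<longleftrightarrow>
      (ws, js) \<in> R \<and> list_all2 (\<lambda>t j. t \<in> ?K j) ts js" for ws js ts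
  proof -
    have "list_all2 (\<lambda>t j. t \<in> ?K j) ts js \<longleftrightarrow>
        map (tree_root sum_species) ts = map (\<lambda>j. Some (j, Start (Gs ! j))) js \<and>
        (\<forall>t \<in> set ts. well_typed sum_species t \<and> holes t = [])"
      by (induction ts js rule: list_induct2') (auto simp: constants_def)
    moreover have "Inl (ws, js) \<in> Nodes sum_species \<longleftrightarrow> (ws, js) \<in> R"
      "NIn sum_species (Inl (ws, js)) = map (\<lambda>j. Some (j, Start (Gs ! j))) js"
      "NOut sum_species (Inl (ws, js)) = None"
      by (auto simp: sum_species_def)
    ultimately show ?thesis
      by (simp add: constants_def) blast
  qed
  have S: "?e ` ?K j = (\<lambda>u. [u]) ` language (Gs ! j)" if "j < length Gs" for j
    using component_language[OF that] .
  have "w \<in> language sum_grammar \<longleftrightarrow>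
    (\<exists>(ws, js) \<in> R. w \<in> spliced_concatenation C ws (map (\<lambda>j. language (Gs ! j)) js))" for w
  proof
    assume "w \<in> language sum_grammar"
    then obtain t where t: "t \<in> constants (Free sum_species) None" "[w] = ?e t"
      by (auto simp: language_def sum_grammar_def)
    \<comment> \<open>A hole would be an input, and component nodes have tagged outputs, so only a
      rule node can be at the root.\<close>
    then obtain ws js ts where n: "t = Node (Inl (ws, js)) ts"
      by (cases t) (auto simp: constants_def sum_species_def)
    have R: "(ws, js) \<in> R" and ts: "list_all2 (\<lambda>t j. t \<in> ?K j) ts js"
      using t(1) unfolding n K by simp_all
    have "list_all2 (\<lambda>x j. x \<in> (\<lambda>u. [u]) ` language (Gs ! j)) (map ?e ts) js"
      unfolding list_all2_map1
      using ts by (rule list.rel_mono_strong) (use rules[OF R] S in blast)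
    \<comment> \<open>Each subtree evaluates to a single arrow; these arrows are collected into one
      list.\<close>
    then have "\<exists>us. map ?e ts = map (\<lambda>u. [u]) us \<and> list_all2 (\<lambda>u j. u \<in> language (Gs ! j)) us js"
    proof (induction rule: list_all2_induct)
      case (Cons x xs j js)
      then obtain u us where "x = [u]" "u \<in> language (Gs ! j)"
        "xs = map (\<lambda>u. [u]) us" "list_all2 (\<lambda>u j. u \<in> language (Gs ! j)) us js"
        by blast
      then show ?case by (intro exI[of _ "u # us"]) simp
    qed simp
    then obtain us where us: "map ?e ts = map (\<lambda>u. [u]) us"
        "list_all2 (\<lambda>u j. u \<in> language (Gs ! j)) us js"
      by blast
    have "w = spliced_composite C ws us"
      using t(2) composite[OF R list_all2_lengthD[OF us(2)]] unfolding n e us(1) by simp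
    then have "w \<in> spliced_concatenation C ws (map (\<lambda>j. language (Gs ! j)) js)"
      using us(2) by (auto simp: spliced_concatenation_def list_all2_map2)
    with R show "\<exists>(ws, js) \<in> R. w \<in> spliced_concatenation C ws (map (\<lambda>j. language (Gs ! j)) js)"
      by blast
  next
    assume "\<exists>(ws, js) \<in> R. w \<in> spliced_concatenation C ws (map (\<lambda>j. language (Gs ! j)) js)"
    then obtain ws js us where R: "(ws, js) \<in> R" and w: "w = spliced_composite C ws us"
      and us: "list_all2 (\<lambda>u j. u \<in> language (Gs ! j)) us js"
      by (auto simp: spliced_concatenation_def list_all2_map2)
    \<comment> \<open>Conversely, each arrow is the value of some tree; these trees become the
      children of the rule node.\<close>
    have "list_all2 (\<lambda>u j. \<exists>t. t \<in> ?K j \<and> ?e t = [u]) us js"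
      using us
    proof (rule list.rel_mono_strong)
      fix u j assume "j \<in> set js" "u \<in> language (Gs ! j)"
      then have "[u] \<in> ?e ` ?K j" using rules[OF R] S by auto
      then show "\<exists>t. t \<in> ?K j \<and> ?e t = [u]" by auto
    qed
    then have "\<exists>ts. map ?e ts = map (\<lambda>u. [u]) us \<and> list_all2 (\<lambda>t j. t \<in> ?K j) ts js"
    proof (induction rule: list_all2_induct)
      case (Cons u us j js)
      then obtain t ts where "t \<in> ?K j" "?e t = [u]" "map ?e ts = map (\<lambda>u. [u]) us"
          "list_all2 (\<lambda>t j. t \<in> ?K j) ts js"
        by blast
      then show ?case by (intro exI[of _ "t # ts"]) simp
    qed simp
    then obtain ts where ts: "map ?e ts = map (\<lambda>u. [u]) us" "list_all2 (\<lambda>t j. t \<in> ?K j) ts js"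
      by blast
    have "?e (Node (Inl (ws, js)) ts) = [w]"
      unfolding e ts(1) w by (rule composite[OF R list_all2_lengthD[OF us]])
    moreover have "Node (Inl (ws, js)) ts \<in> constants (Free sum_species) None"
      using R ts(2) K by simp
    ultimately have "[w] \<in> ?e ` constants (Free sum_species) None"
      by (metis imageI)
    then show "w \<in> language sum_grammar"
      by (simp add: language_def sum_grammar_def)
  qed
  then show ?thesis by blast
qed

lemma context_free_language_rules:
  "context_free_language C A B
    (\<Union>(ws, js) \<in> R. spliced_concatenation C ws (map (\<lambda>j. language (Gs ! j)) js))"
proof -
  have "PCol sum_grammar (Start sum_grammar) = (A, B)" and C: "Base sum_grammar = C"
    by (simp_all add: sum_grammar_def sum_color_def)
  from context_free_languageI[OF context_free_sum_grammar this(1)]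
  show ?thesis unfolding C language_sum_grammar .
qed

end

section \<open>Functoriality of spliced arrows\<close>

context cat_functor
begin

lemma spliced_ins_map:
  assumes "set ws \<subseteq> Arr C"
  shows "spliced_ins D (map Fa ws) = map (map_prod Fo Fo) (spliced_ins C ws)"
proof -
  have "set (butlast ws) \<subseteq> Arr C"
    using assms by (auto dest: in_set_butlastD)
  moreover have "set (tl ws) \<subseteq> Arr C"
    using assms by (cases ws) simp_all
  ultimately have "map (Cod D \<circ> Fa) (butlast ws) = map (Fo \<circ> Cod C) (butlast ws)"
    "map (Dom D \<circ> Fa) (tl ws) = map (Fo \<circ> Dom C) (tl ws)"
    by (auto simp: Cod_Fa Dom_Fa)
  then have "spliced_ins D (map Fa ws)
      = zip (map Fo (map (Cod C) (butlast ws))) (map Fo (map (Dom C) (tl ws)))"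
    by (simp only: map_butlast[symmetric] map_tl[symmetric] map_map)
  then show ?thesis
    by (simp only: zip_map_map map_prod_def)
qed

text \<open>Only the composite at the junction needs functoriality, whence the composability
  assumption.\<close>

lemma map_juxtapose:
  assumes "spl ws" "spl us" "Cod C (last ws) = Dom C (hd us)"
  shows "map Fa (juxtapose C ws us) = juxtapose D (map Fa ws) (map Fa us)"
proof -
  have "last ws \<in> Arr C" "hd us \<in> Arr C" using assms by auto
  then show ?thesis
    using assms by (simp add: juxtapose_def Fa_Comp map_butlast map_tl last_map hd_map)
qed

text \<open>Induction along the recursion of \<open>plug_arrows\<close>: each gap creates two
  junctions, whose composability follows from the typing of the partial results.\<close>

lemma map_plug_arrows:
  "spl ws \<Longrightarrow> \<forall>u \<in> set us. spl u \<Longrightarrow> map out us = spliced_ins C ws \<Longrightarrow>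
    map Fa (plug_arrows C ws us) = plug_arrows D (map Fa ws) (map (map Fa) us)"
proof (induction ws arbitrary: us rule: induct_list012)
  case (3 w w' ws)
  from 3(5) obtain u us' where us: "us = u # us'" "out u = (Cod C w, Dom C w')"
      "map out us' = spliced_ins C (w' # ws)"
    by auto
  let ?r = "plug_arrows C (w' # ws) us'"
  have r: "spl ?r" "out ?r = out (w' # ws)"
    using plug_arrows_typed[of "w' # ws" us'] 3(3,4) us by auto
  have j: "spl (juxtapose C u ?r)" "Dom C (hd (juxtapose C u ?r)) = Dom C (hd u)"
    using juxtapose_typed[of ?r u] r us 3(4) by auto
  have "map Fa (plug_arrows C (w # w' # ws) us) = map Fa (juxtapose C [w] (juxtapose C u ?r))"
    using us by simp
  also have "\<dots> = juxtapose D [Fa w] (juxtapose D (map Fa u) (map Fa ?r))"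
    using map_juxtapose[of "[w]" "juxtapose C u ?r"] map_juxtapose[of u ?r] j r us 3(3,4) by auto
  also have "map Fa ?r = plug_arrows D (map Fa (w' # ws)) (map (map Fa) us')"
    using 3(2)[of us'] 3(3,4) us by simp
  finally show ?case using us by simp
qed simp_all

text \<open>The action of the spliced arrow construction on functors of categories.\<close>

lemma operad_functor_Spliced:
  "operad_functor (Spliced C) (Spliced D) (map_prod Fo Fo) (map Fa)"
  unfolding operad_functor_def
proof (intro conjI ballI allI impI)
  fix c assume "c \<in> Colors (Spliced C)"
  then show "map_prod Fo Fo c \<in> Colors (Spliced D)"
    "map Fa (Unit (Spliced C) c) = Unit (Spliced D) (map_prod Fo Fo c)"
    by (auto simp: Fo_Obj Fa_Ident)
next
  fix f assume f: "f \<in> Ops (Spliced C)"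
  then show "map Fa f \<in> Ops (Spliced D)" by (auto simp: Fa_Arr)
  show "Ins (Spliced D) (map Fa f) = map (map_prod Fo Fo) (Ins (Spliced C) f)"
    using f spliced_ins_map[of f] by simp
  have "hd f \<in> Arr C" "last f \<in> Arr C" using f by auto
  then show "Out (Spliced D) (map Fa f) = map_prod Fo Fo (Out (Spliced C) f)"
    using f by (simp add: hd_map last_map Dom_Fa Cod_Fa)
next
  fix f gs assume "pluggable (Spliced C) f gs"
  then have "spl f" "\<forall>g \<in> set gs. spl g" "map out gs = spliced_ins C f"
    by (auto simp: pluggable_def Spliced_def)
  from map_plug_arrows[OF this]
  show "map Fa (Plug (Spliced C) f gs) = Plug (Spliced D) (map Fa f) (map (map Fa) gs)"
    by simp
qed

text \<open>Species and start color are kept; only the functor out of the free operad is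
  post-composed.\<close>

lemma context_free_language_image:
  assumes D: "finitely_generated D" and L: "context_free_language C A B L"
  shows "context_free_language D (Fo A) (Fo B) (Fa ` L)"
proof -
  obtain G :: "('o, 'a, nat, nat) grammar" where G: "context_free_grammar G" "Base G = C"
    "PCol G (Start G) = (A, B)" "language G = L"
    using L unfolding context_free_language_def by blast
  define H :: "('p, 'b, nat, nat) grammar" where
    "H = \<lparr>Base = D, Spec = Spec G, Start = Start G, PCol = map_prod Fo Fo \<circ> PCol G,
      POp = map Fa \<circ> POp G\<rparr>"
  have "operad_functor (Free (Spec G)) (Spliced C) (PCol G) (POp G)"
    using G(1,2) by (simp add: context_free_grammar_def)
  from operad_functor_comp[OF this operad_functor_Spliced] have "context_free_grammar H"
    using G(1) D D.category_axioms by (simp add: context_free_grammar_def H_def)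
  moreover have "PCol H (Start H) = (Fo A, Fo B)" "Base H = D"
    using G(3) by (simp_all add: H_def)
  moreover have "language H = Fa ` L"
  proof -
    have "POp G ` constants (Free (Spec G)) (Start G) = (\<lambda>u. [u]) ` L"
      using POp_constants[OF G(1)] G(4) by simp
    then have "map Fa ` POp G ` constants (Free (Spec G)) (Start G) = (\<lambda>u. [Fa u]) ` L"
      by (simp only: image_image list.map)
    then have "POp H ` constants (Free (Spec H)) (Start H) = (\<lambda>u. [Fa u]) ` L"
      by (simp add: H_def image_image)
    then show ?thesis by (auto simp: language_def)
  qed
  ultimately show ?thesis
    unfolding context_free_language_def by blast
qed

end

section \<open>Closure properties\<close>

text \<open>The rule \<open>id-id\<close> copies a language; the typing of its arrows is what the
  identity laws need.\<close>

lemma (in category) spliced_concatenation_Ident: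
  assumes "\<forall>u \<in> L. u \<in> Arr C \<and> Dom C u = A \<and> Cod C u = B"
  shows "spliced_concatenation C [Ident C A, Ident C B] [L] = L"
proof -
  have "spliced_composite C [Ident C A, Ident C B] [u] = u" if "u \<in> L" for u
    using assms that Ident_Comp[of u] Comp_Ident[of u] by auto
  then show ?thesis
    by (force simp: spliced_concatenation_def list_all2_Cons2)
qed

lemma (in category) context_free_language_Un:
  assumes fg: "finitely_generated C"
    and "context_free_language C A B L1" "context_free_language C A B L2"
  shows "context_free_language C A B (L1 \<union> L2)"
proof -
  obtain G1 G2 :: "('o, 'a, nat, nat) grammar" where
    G1: "context_free_grammar G1" "Base G1 = C" "PCol G1 (Start G1) = (A, B)" "language G1 = L1" and
    G2: "context_free_grammar G2" "Base G2 = C" "PCol G2 (Start G2) = (A, B)" "language G2 = L2"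
    using assms(2,3) unfolding context_free_language_def by blast
  \<comment> \<open>\<open>L1\<close> and \<open>L2\<close> may be empty, so \<open>A\<close> and
    \<open>B\<close> are seen to be objects through the color map instead of through arrows.\<close>
  have "PCol G1 (Start G1) \<in> Obj C \<times> Obj C"
    using G1(1,2) by (simp add: context_free_grammar_def operad_functor_def)
  then have AB: "A \<in> Obj C" "B \<in> Obj C" by (simp_all add: G1(3))
  \<comment> \<open>The two rules share their spliced arrow; the index lists keep them distinct as
    nodes.\<close>
  let ?R = "{([Ident C A, Ident C B], [0]), ([Ident C A, Ident C B], [1])}"
  interpret spliced_rules C "[G1, G2]" ?R A B
  proof (unfold_locales, goal_cases)
    \<comment> \<open>Goals 4 and 6 are the locale assumptions \<open>grammars\<close> and
      \<open>rules\<close>.\<close>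
    case (4 i)
    then show ?case using G1(1,2) G2(1,2) by (cases i) simp_all
  next
    case (6 ws js)
    then show ?case using AB G1(3) G2(3) by (auto simp: Ident_Arr Dom_Ident Cod_Ident)
  qed (use fg AB in simp_all)
  have "\<forall>u \<in> L1. u \<in> Arr C \<and> Dom C u = A \<and> Cod C u = B"
    using language_Arr[OF G1(1)] unfolding G1(2-4) by simp
  moreover have "\<forall>u \<in> L2. u \<in> Arr C \<and> Dom C u = A \<and> Cod C u = B"
    using language_Arr[OF G2(1)] unfolding G2(2-4) by simp
  ultimately have "spliced_concatenation C [Ident C A, Ident C B] [L1] = L1"
    "spliced_concatenation C [Ident C A, Ident C B] [L2] = L2"
    by (simp_all add: spliced_concatenation_Ident)
  with context_free_language_rules show ?thesis
    by (simp add: G1(4) G2(4))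
qed

text \<open>Finite choice along two lists; it picks one grammar for each gap and its
  language.\<close>

lemma list_all2_choice:
  assumes "list_all2 (\<lambda>x y. \<exists>z. P z \<and> f z = x \<and> g z = y) xs ys"
  shows "\<exists>zs. (\<forall>z \<in> set zs. P z) \<and> map f zs = xs \<and> map g zs = ys"
  using assms
proof (induction rule: list_all2_induct)
  case (Cons x xs y ys)
  then obtain z zs where "P z" "f z = x" "g z = y" "\<forall>z \<in> set zs. P z" "map f zs = xs" "map g zs = ys"
    by blast
  then show ?case by (intro exI[of _ "z # zs"]) simp
qed simp

lemma (in category) context_free_language_spliced_concatenation:
  assumes fg: "finitely_generated C"
    and ws: "spl ws" "out ws = (A, B)"
    and Ls: "list_all2 (\<lambda>(Ai, Bi) Li. context_free_language C Ai Bi Li) (spliced_ins C ws) Ls"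
  shows "context_free_language C A B (spliced_concatenation C ws Ls)"
proof -
  have "list_all2 (\<lambda>p Li. \<exists>G :: ('o, 'a, nat, nat) grammar. (context_free_grammar G \<and> Base G = C) \<and>
      PCol G (Start G) = p \<and> language G = Li) (spliced_ins C ws) Ls"
    using Ls by (rule list_all2_mono) (simp only: context_free_language_def split_paired_all prod.case conj_assoc)
  then have "\<exists>Gs :: ('o, 'a, nat, nat) grammar list.
      (\<forall>G \<in> set Gs. context_free_grammar G \<and> Base G = C) \<and>
      map (\<lambda>G. PCol G (Start G)) Gs = spliced_ins C ws \<and> map language Gs = Ls"
    by (rule list_all2_choice)
  then obtain Gs :: "('o, 'a, nat, nat) grammar list" where
    Gs: "\<forall>G \<in> set Gs. context_free_grammar G \<and> Base G = C"
    "map (\<lambda>G. PCol G (Start G)) Gs = spliced_ins C ws" "map language Gs = Ls"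
    by blast
  \<comment> \<open>Polymorphic in the result: used with start colors to type the rule and with
    languages to read off the conclusion.\<close>
  have nth: "map (\<lambda>j. f (Gs ! j)) [0..<length Gs] = map f Gs" for f :: "_ \<Rightarrow> 'z"
    by (rule nth_equalityI) simp_all
  have AB: "A \<in> Obj C" "B \<in> Obj C"
    using ws Dom_Obj[of "hd ws"] Cod_Obj[of "last ws"] by (auto simp: subset_iff)
  \<comment> \<open>A single rule that uses each grammar exactly once, in order.\<close>
  interpret spliced_rules C Gs "{(ws, [0..<length Gs])}" A B
  proof (unfold_locales, goal_cases)
    case (4 i)
    then show ?case using Gs(1) by simp
  next
    case (6 ws' js)
    then show ?case using ws Gs(2) by (simp add: nth[of "\<lambda>G. PCol G (Start G)"])
  qed (use fg AB in simp_all)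
  from context_free_language_rules show ?thesis
    by (simp add: nth Gs(3))
qed

theorem proposition2p9:
  fixes C :: "('o, 'a) category" and D :: "('p, 'b) category"
  assumes "category C" and "finitely_generated C"
    and "category D" and "finitely_generated D"
  shows
    "(\<forall>A B L1 L2. context_free_language C A B L1 \<longrightarrow> context_free_language C A B L2 \<longrightarrow>
        context_free_language C A B (L1 \<union> L2)) \<and>
     (\<forall>A B ws Ls. ws \<in> Ops (Spliced C) \<longrightarrow> Out (Spliced C) ws = (A, B) \<longrightarrow>
        list_all2 (\<lambda>(Ai, Bi) Li. context_free_language C Ai Bi Li) (Ins (Spliced C) ws) Ls \<longrightarrow>
        context_free_language C A B (spliced_concatenation C ws Ls)) \<and>
     (\<forall>A B L Fo Fa. context_free_language C A B L \<longrightarrow> cat_functor C D Fo Fa \<longrightarrow>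
        context_free_language D (Fo A) (Fo B) (Fa ` L))"
proof (intro conjI allI impI)
  show "context_free_language C A B (L1 \<union> L2)"
    if "context_free_language C A B L1" "context_free_language C A B L2" for A B L1 L2
    using category.context_free_language_Un[OF assms(1,2) that] .
  show "context_free_language C A B (spliced_concatenation C ws Ls)"
    if "ws \<in> Ops (Spliced C)" "Out (Spliced C) ws = (A, B)"
      "list_all2 (\<lambda>(Ai, Bi) Li. context_free_language C Ai Bi Li) (Ins (Spliced C) ws) Ls"
    for A B ws Ls
    using category.context_free_language_spliced_concatenation[OF assms(1,2)] that
    unfolding Spliced_simps mem_Collect_eq .
  show "context_free_language D (Fo A) (Fo B) (Fa ` L)"
    if "context_free_language C A B L" "cat_functor C D Fo Fa" for A B L Fo Fa
    using cat_functor.context_free_language_image[OF that(2) assms(4) that(1)] .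
qed

end
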